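(* Let $T$ be a complete stable $\mathcal L$-theory without finite models which does not have the finite cover property, and let $\Delta=\Delta(x;y)$ be a finite set of partitioned $\mathcal L$-formulas. Let $\varrho=R_\Delta(T)$. Then $\pi^*_\Delta(t)=O(t^\varrho)$, and hence $\mathrm{vc}^*(\Delta)\le\varrho$.
   Context: Work in a monster model $\mathbf M$ of $T$. For $B\subseteq M^{|y|}$ finite, a $\Delta(x;B)$-type is a consistent subset of $\{\varphi(x;b),\neg\varphi(x;b):\varphi\in\Delta,b\in B\}$; $S^\Delta(B)$ is the set of complete such types realized in $\mathbf M$. $\pi^*_\Delta(t):=\max\{|S^\Delta(B)|:B\subseteq M^{|y|},|B|=t\}$ and $\mathrm{vc}^*(\Delta)=\inf\{r\ge0:\pi^*_\Delta(t)=O(t^r)\}$. $R_\Delta$ is Shelah's local rank $R^m(-,\Delta,\aleph_0)$: for a set $\Theta(x)$ of formulas with parameters, $R_\Delta(\Theta)$ is the Cantor–Bendixson rank of the closed set of complete global $\Delta$-types (complete consistent sets of instances $\varphi(x;b)$, $\neg\varphi(x;b)$, $\varphi\in\Delta$, $b$ from $M$, with the usual Stone topology) consistent with $\Theta$; $R_\Delta(T):=R_\Delta(x=x)$. The finite cover property: some formula $\varphi(x;y)$ admits, for arbitrarily large $t$, $b_1,\dots,b_t$ with $\{\varphi(x;b_i)\}_{i\le t}$ inconsistent but every proper subset consistent. *)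

theory Defs
  imports
    "HOL-Analysis.Analysis"
    "HOL-Library.Landau_Symbols"
    "HOL-Library.NList"
begin

unbundle cardinal_syntax

section \<open>First-order logic\<close>

text \<open>A language is given by its function and relation symbols, each paired with its arity.\<close>

record ('f, 'r) language =
  Funs :: "('f \<times> nat) set"
  Rels :: "('r \<times> nat) set"

text \<open>Variables are de Bruijn indices; \<open>Ex\<close> binds index 0.\<close>

datatype 'f trm = Var nat | Fun 'f "'f trm list"

datatype ('f, 'r) fm =
    Eq "'f trm" "'f trm"
  | Rel 'r "'f trm list"
  | Neg "('f, 'r) fm"
  | Conj "('f, 'r) fm" "('f, 'r) fm"
  | Ex "('f, 'r) fm"

primrec vars_trm :: "'f trm \<Rightarrow> nat set" where
  "vars_trm (Var i) = {i}"
| "vars_trm (Fun f ts) = \<Union> (set (map vars_trm ts))"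

primrec free_vars :: "('f, 'r) fm \<Rightarrow> nat set" where
  "free_vars (Eq s t) = vars_trm s \<union> vars_trm t"
| "free_vars (Rel r ts) = \<Union> (vars_trm ` set ts)"
| "free_vars (Neg \<phi>) = free_vars \<phi>"
| "free_vars (Conj \<phi> \<psi>) = free_vars \<phi> \<union> free_vars \<psi>"
| "free_vars (Ex \<phi>) = {i. Suc i \<in> free_vars \<phi>}"

primrec funs_trm :: "'f trm \<Rightarrow> ('f \<times> nat) set" where
  "funs_trm (Var i) = {}"
| "funs_trm (Fun f ts) = insert (f, length ts) (\<Union> (set (map funs_trm ts)))"

primrec funs_fm :: "('f, 'r) fm \<Rightarrow> ('f \<times> nat) set" where
  "funs_fm (Eq s t) = funs_trm s \<union> funs_trm t"
| "funs_fm (Rel r ts) = \<Union> (funs_trm ` set ts)"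
| "funs_fm (Neg \<phi>) = funs_fm \<phi>"
| "funs_fm (Conj \<phi> \<psi>) = funs_fm \<phi> \<union> funs_fm \<psi>"
| "funs_fm (Ex \<phi>) = funs_fm \<phi>"

primrec rels_fm :: "('f, 'r) fm \<Rightarrow> ('r \<times> nat) set" where
  "rels_fm (Eq s t) = {}"
| "rels_fm (Rel r ts) = {(r, length ts)}"
| "rels_fm (Neg \<phi>) = rels_fm \<phi>"
| "rels_fm (Conj \<phi> \<psi>) = rels_fm \<phi> \<union> rels_fm \<psi>"
| "rels_fm (Ex \<phi>) = rels_fm \<phi>"

definition formulas :: "('f, 'r) language \<Rightarrow> ('f, 'r) fm set" where
  "formulas L = {\<phi>. funs_fm \<phi> \<subseteq> Funs L \<and> rels_fm \<phi> \<subseteq> Rels L}"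

definition formulas_in :: "('f, 'r) language \<Rightarrow> nat \<Rightarrow> ('f, 'r) fm set" where
  "formulas_in L k = {\<phi> \<in> formulas L. free_vars \<phi> \<subseteq> {..<k}}"

abbreviation sentences :: "('f, 'r) language \<Rightarrow> ('f, 'r) fm set" where
  "sentences L \<equiv> formulas_in L 0"

record ('f, 'r, 'm) fo_struct =
  univ :: "'m set"
  fun_interp :: "'f \<Rightarrow> 'm list \<Rightarrow> 'm"
  rel_interp :: "'r \<Rightarrow> 'm list \<Rightarrow> bool"

definition is_structure :: "('f, 'r) language \<Rightarrow> ('f, 'r, 'm) fo_struct \<Rightarrow> bool" where
  "is_structure L M \<longleftrightarrow> univ M \<noteq> {} \<and>
     (\<forall>(f, k) \<in> Funs L. \<forall>xs \<in> nlists k (univ M). fun_interp M f xs \<in> univ M)"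

primrec eval_trm :: "('f, 'r, 'm) fo_struct \<Rightarrow> (nat \<Rightarrow> 'm) \<Rightarrow> 'f trm \<Rightarrow> 'm" where
  "eval_trm M e (Var i) = e i"
| "eval_trm M e (Fun f ts) = fun_interp M f (map (eval_trm M e) ts)"

primrec sat :: "('f, 'r, 'm) fo_struct \<Rightarrow> (nat \<Rightarrow> 'm) \<Rightarrow> ('f, 'r) fm \<Rightarrow> bool" where
  "sat M e (Eq s t) \<longleftrightarrow> eval_trm M e s = eval_trm M e t"
| "sat M e (Rel r ts) \<longleftrightarrow> rel_interp M r (map (eval_trm M e) ts)"
| "sat M e (Neg \<phi>) \<longleftrightarrow> \<not> sat M e \<phi>"
| "sat M e (Conj \<phi> \<psi>) \<longleftrightarrow> sat M e \<phi> \<and> sat M e \<psi>"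
| "sat M e (Ex \<phi>) \<longleftrightarrow> (\<exists>d \<in> univ M. sat M (case_nat d e) \<phi>)"

text \<open>Evaluation at a tuple \<open>xs\<close>; meaningful when the free variables of \<open>\<phi>\<close> are below
  \<open>length xs\<close>.\<close>

definition holds :: "('f, 'r, 'm) fo_struct \<Rightarrow> ('f, 'r) fm \<Rightarrow> 'm list \<Rightarrow> bool" where
  "holds M \<phi> xs \<longleftrightarrow> sat M (\<lambda>i. xs ! i) \<phi>"

section \<open>Theories and monster models\<close>

definition models :: "('f, 'r) language \<Rightarrow> ('f, 'r) fm set \<Rightarrow> ('f, 'r, 'm) fo_struct \<Rightarrow> bool" where
  "models L T M \<longleftrightarrow> is_structure L M \<and> (\<forall>\<sigma> \<in> T. holds M \<sigma> [])"

text \<open>HOL cannot quantify over all types inside a formula, so consequence ranges over the models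
  whose universe is a subset of a given type \<open>'m\<close>. By Loewenheim--Skolem this is the usual notion
  as soon as \<open>'m\<close> has at least as many elements as there are formulas of the language, which is the
  case for the type carrying a monster model of a theory without finite models.\<close>

definition entails ::
    "'m itself \<Rightarrow> ('f, 'r) language \<Rightarrow> ('f, 'r) fm set \<Rightarrow> ('f, 'r) fm \<Rightarrow> bool" where
  "entails TYPE('m) L T \<sigma> \<longleftrightarrow>
     (\<forall>N :: ('f, 'r, 'm) fo_struct. models L T N \<longrightarrow> holds N \<sigma> [])"

definition complete_theory ::
    "'m itself \<Rightarrow> ('f, 'r) language \<Rightarrow> ('f, 'r) fm set \<Rightarrow> bool" where
  "complete_theory TYPE('m) L T \<longleftrightarrow>
     T \<subseteq> sentences L \<and>
     (\<exists>N :: ('f, 'r, 'm) fo_struct. models L T N) \<and>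
     (\<forall>\<sigma> \<in> sentences L. entails TYPE('m) L T \<sigma> \<or> entails TYPE('m) L T (Neg \<sigma>))"

definition no_finite_models ::
    "'m itself \<Rightarrow> ('f, 'r) language \<Rightarrow> ('f, 'r) fm set \<Rightarrow> bool" where
  "no_finite_models TYPE('m) L T \<longleftrightarrow>
     (\<forall>N :: ('f, 'r, 'm) fo_struct. models L T N \<longrightarrow> infinite (univ N))"

text \<open>A formula \<open>\<phi>(x;b)\<close> with parameters is a pair \<open>(\<phi>, b)\<close>. If \<open>x\<close> has length \<open>m\<close>, then
  \<open>x\<close> occupies the indices below \<open>m\<close> and the parameters the indices from \<open>m\<close> on.\<close>

type_synonym ('f, 'r, 'm) pfm = "('f, 'r) fm \<times> 'm list"

definition realizes :: "('f, 'r, 'm) fo_struct \<Rightarrow> 'm list \<Rightarrow> ('f, 'r, 'm) pfm set \<Rightarrow> bool" where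
  "realizes M a p \<longleftrightarrow> (\<forall>(\<phi>, b) \<in> p. holds M \<phi> (a @ b))"

definition realized :: "('f, 'r, 'm) fo_struct \<Rightarrow> nat \<Rightarrow> ('f, 'r, 'm) pfm set \<Rightarrow> bool" where
  "realized M m p \<longleftrightarrow> (\<exists>a \<in> nlists m (univ M). realizes M a p)"

text \<open>Consistency with the elementary diagram of \<open>M\<close>, i.e. finite satisfiability in \<open>M\<close>.\<close>

definition consistent :: "('f, 'r, 'm) fo_struct \<Rightarrow> nat \<Rightarrow> ('f, 'r, 'm) pfm set \<Rightarrow> bool" where
  "consistent M m p \<longleftrightarrow> (\<forall>q \<subseteq> p. finite q \<longrightarrow> realized M m q)"

definition saturated :: "'k rel \<Rightarrow> ('f, 'r) language \<Rightarrow> ('f, 'r, 'm) fo_struct \<Rightarrow> bool" where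
  "saturated \<kappa> L M \<longleftrightarrow>
     (\<forall>m A p. A \<subseteq> univ M \<and> |A| <o \<kappa> \<and>
        p \<subseteq> {(\<phi>, b). set b \<subseteq> A \<and> \<phi> \<in> formulas_in L (m + length b)} \<and>
        consistent M m p \<longrightarrow> realized M m p)"

definition elementary_map ::
    "('f, 'r) language \<Rightarrow> ('f, 'r, 'm) fo_struct \<Rightarrow> 'm set \<Rightarrow> ('m \<Rightarrow> 'm) \<Rightarrow> bool" where
  "elementary_map L M A g \<longleftrightarrow> g ` A \<subseteq> univ M \<and>
     (\<forall>k. \<forall>\<phi> \<in> formulas_in L k. \<forall>xs \<in> nlists k A. holds M \<phi> (map g xs) \<longleftrightarrow> holds M \<phi> xs)"

definition automorphism ::
    "('f, 'r) language \<Rightarrow> ('f, 'r, 'm) fo_struct \<Rightarrow> ('m \<Rightarrow> 'm) \<Rightarrow> bool" where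
  "automorphism L M h \<longleftrightarrow> bij_betw h (univ M) (univ M) \<and>
     (\<forall>(f, k) \<in> Funs L. \<forall>xs \<in> nlists k (univ M).
        h (fun_interp M f xs) = fun_interp M f (map h xs)) \<and>
     (\<forall>(r, k) \<in> Rels L. \<forall>xs \<in> nlists k (univ M).
        rel_interp M r (map h xs) \<longleftrightarrow> rel_interp M r xs)"

definition strongly_homogeneous ::
    "'k rel \<Rightarrow> ('f, 'r) language \<Rightarrow> ('f, 'r, 'm) fo_struct \<Rightarrow> bool" where
  "strongly_homogeneous \<kappa> L M \<longleftrightarrow>
     (\<forall>A g. A \<subseteq> univ M \<and> |A| <o \<kappa> \<and> elementary_map L M A g \<longrightarrow>
        (\<exists>h. automorphism L M h \<and> (\<forall>a \<in> A. h a = g a)))"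

text \<open>The set of formulas is always infinite, so \<open>|formulas L|\<close> is the usual cardinal
  \<open>|L| + \<aleph>\<^sub>0\<close>.\<close>

definition monster_model ::
    "'k rel \<Rightarrow> ('f, 'r) language \<Rightarrow> ('f, 'r) fm set \<Rightarrow> ('f, 'r, 'm) fo_struct \<Rightarrow> bool" where
  "monster_model \<kappa> L T M \<longleftrightarrow>
     models L T M \<and> Card_order \<kappa> \<and> |formulas L| <o \<kappa> \<and>
     saturated \<kappa> L M \<and> strongly_homogeneous \<kappa> L M"

section \<open>Stability and the finite cover property\<close>

text \<open>A partitioned formula \<open>\<phi>(x;y)\<close> with \<open>|x| = m\<close> and \<open>|y| = n\<close> is an element of
  \<open>formulas_in L (m + n)\<close>. The following notions are properties of the theory, read off in its
  monster model \<open>M\<close>.\<close>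

definition order_property ::
    "('f, 'r, 'm) fo_struct \<Rightarrow> nat \<Rightarrow> nat \<Rightarrow> ('f, 'r) fm \<Rightarrow> bool" where
  "order_property M m n \<phi> \<longleftrightarrow>
     (\<exists>(a :: nat \<Rightarrow> 'm list) (b :: nat \<Rightarrow> 'm list).
        range a \<subseteq> nlists m (univ M) \<and> range b \<subseteq> nlists n (univ M) \<and>
        (\<forall>i j. holds M \<phi> (a i @ b j) \<longleftrightarrow> i < j))"

definition stable_theory :: "('f, 'r) language \<Rightarrow> ('f, 'r, 'm) fo_struct \<Rightarrow> bool" where
  "stable_theory L M \<longleftrightarrow> (\<forall>m n. \<forall>\<phi> \<in> formulas_in L (m + n). \<not> order_property M m n \<phi>)"

text \<open>The parameters \<open>b\<^sub>1, \<dots>, b\<^sub>t\<close> are pairwise distinct, since every proper subfamily of the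
  \<open>\<phi>(x;b\<^sub>i)\<close> is to be consistent; they are collected in a set of size \<open>t\<close>.\<close>

definition finite_cover_property ::
    "('f, 'r) language \<Rightarrow> ('f, 'r, 'm) fo_struct \<Rightarrow> bool" where
  "finite_cover_property L M \<longleftrightarrow>
     (\<exists>m n. \<exists>\<phi> \<in> formulas_in L (m + n). \<forall>N. \<exists>t \<ge> N. \<exists>B \<subseteq> nlists n (univ M).
        finite B \<and> card B = t \<and>
        \<not> consistent M m ({\<phi>} \<times> B) \<and>
        (\<forall>B' \<subset> B. consistent M m ({\<phi>} \<times> B')))"

section \<open>Local types, dual VC density and local rank\<close>

definition literals :: "('f, 'r) fm set \<Rightarrow> 'm list set \<Rightarrow> ('f, 'r, 'm) pfm set" where
  "literals \<Delta> B = \<Delta> \<times> B \<union> (Neg ` \<Delta>) \<times> B"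

definition complete_types ::
    "('f, 'r, 'm) fo_struct \<Rightarrow> nat \<Rightarrow> ('f, 'r) fm set \<Rightarrow> 'm list set \<Rightarrow> ('f, 'r, 'm) pfm set set" where
  "complete_types M m \<Delta> B =
     {p. p \<subseteq> literals \<Delta> B \<and> consistent M m p \<and>
         (\<forall>\<phi> \<in> \<Delta>. \<forall>b \<in> B. (\<phi>, b) \<in> p \<or> (Neg \<phi>, b) \<in> p)}"

definition S_Delta ::
    "('f, 'r, 'm) fo_struct \<Rightarrow> nat \<Rightarrow> ('f, 'r) fm set \<Rightarrow> 'm list set \<Rightarrow> ('f, 'r, 'm) pfm set set" where
  "S_Delta M m \<Delta> B = {p \<in> complete_types M m \<Delta> B. realized M m p}"

text \<open>The supremum is over a set bounded by \<open>2 ^ (card \<Delta> * t)\<close>, hence a maximum, unless there is no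
  \<open>B\<close> of size \<open>t\<close> (possible only for \<open>n = 0\<close> when \<open>M\<close> is infinite), where it is 0.\<close>

definition pi_dual ::
    "('f, 'r, 'm) fo_struct \<Rightarrow> nat \<Rightarrow> nat \<Rightarrow> ('f, 'r) fm set \<Rightarrow> nat \<Rightarrow> nat" where
  "pi_dual M m n \<Delta> t =
     Sup {card (S_Delta M m \<Delta> B) | B. B \<subseteq> nlists n (univ M) \<and> finite B \<and> card B = t}"

definition vc_dual ::
    "('f, 'r, 'm) fo_struct \<Rightarrow> nat \<Rightarrow> nat \<Rightarrow> ('f, 'r) fm set \<Rightarrow> ereal" where
  "vc_dual M m n \<Delta> =
     Inf (ereal ` {r. 0 \<le> r \<and> (\<lambda>t. real (pi_dual M m n \<Delta> t)) \<in> O(\<lambda>t. real t powr r)})"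

definition cb_derivative :: "'a topology \<Rightarrow> nat \<Rightarrow> 'a set \<Rightarrow> 'a set" where
  "cb_derivative X k = (\<lambda>C. C \<inter> X derived_set_of C) ^^ k"

text \<open>The Cantor--Bendixson rank of a closed subset \<open>C\<close> of a compact space: \<open>-\<infinity>\<close> for the empty set,
  the last \<open>k\<close> with nonempty \<open>k\<close>-th derivative if this is finite; the infinite ordinal values and the
  value for a nonempty perfect kernel are not distinguished and all become \<open>\<infinity>\<close>.\<close>

definition cb_rank :: "'a topology \<Rightarrow> 'a set \<Rightarrow> ereal" where
  "cb_rank X C = Sup ((\<lambda>k. ereal (real k)) ` {k. cb_derivative X k C \<noteq> {}})"

definition global_types ::
    "('f, 'r, 'm) fo_struct \<Rightarrow> nat \<Rightarrow> nat \<Rightarrow> ('f, 'r) fm set \<Rightarrow> ('f, 'r, 'm) pfm set set" where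
  "global_types M m n \<Delta> = complete_types M m \<Delta> (nlists n (univ M))"

text \<open>The whole space is added to the subbasis for the case \<open>\<Delta> = {}\<close>.\<close>

definition stone_topology ::
    "('f, 'r, 'm) fo_struct \<Rightarrow> nat \<Rightarrow> nat \<Rightarrow> ('f, 'r) fm set \<Rightarrow> ('f, 'r, 'm) pfm set topology" where
  "stone_topology M m n \<Delta> =
     topology_generated_by
       (insert (global_types M m n \<Delta>)
         ((\<lambda>l. {p \<in> global_types M m n \<Delta>. l \<in> p}) ` literals \<Delta> (nlists n (univ M))))"

definition R_Delta ::
    "('f, 'r, 'm) fo_struct \<Rightarrow> nat \<Rightarrow> nat \<Rightarrow> ('f, 'r) fm set \<Rightarrow> ('f, 'r, 'm) pfm set \<Rightarrow> ereal" where
  "R_Delta M m n \<Delta> \<Theta> =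
     cb_rank (stone_topology M m n \<Delta>) {p \<in> global_types M m n \<Delta>. consistent M m (p \<union> \<Theta>)}"

text \<open>The partial type \<open>x = x\<close> for a tuple \<open>x\<close> of length \<open>m\<close>, written coordinatewise.\<close>

definition x_eq_x :: "nat \<Rightarrow> ('f, 'r, 'm) pfm set" where
  "x_eq_x m = {(Eq (Var i) (Var i), []) | i. i < m}"

definition R_Delta_theory ::
    "('f, 'r, 'm) fo_struct \<Rightarrow> nat \<Rightarrow> nat \<Rightarrow> ('f, 'r) fm set \<Rightarrow> ereal" where
  "R_Delta_theory M m n \<Delta> = R_Delta M m n \<Delta> (x_eq_x m)"

end

theory Submission
  imports Defs
begin

text \<open>
  Stability bounds the heights of binary trees of instances of \<open>\<Delta>\<close>. Since a type of
  Cantor--Bendixson rank at least \<open>k\<close> yields a tree of height \<open>k\<close>, the rank \<open>\<rho>\<close> is finite, and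
  a type is determined by boundedly many of its literals together with the tree rank they have, so
  that all global types lie in finitely many uniformly definable families. Without the finite cover
  property, consistency of a definable family of formulas can be tested on subfamilies of bounded
  size; hence every Cantor--Bendixson derivative is definable in terms of the parameters of the
  families, and a set cut out by \<open>r\<close> literals which meets the \<open>k\<close>-th derivative in a finite set
  meets it in at most \<open>N(k, r)\<close> points.

  If such a set \<open>U\<close> misses the \<open>(k+1)\<close>-st derivative, split it by boundedly many literals until it
  contains at most one point \<open>p\<close> of the \<open>k\<close>-th derivative. A type in \<open>U\<close> then either agrees with
  \<open>p\<close> over \<open>B\<close> or lies in one of at most \<open>|\<Delta>| |B|\<close> sets missing the \<open>k\<close>-th derivative, and
  induction on \<open>k\<close> gives \<open>O(|B|^k)\<close> types over \<open>B\<close> in \<open>U\<close>.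
\<close>

section \<open>Binary trees and ladders\<close>

text \<open>The obstacle is uniformity. Compactness makes \<open>fits ls \<inter> D k\<close> finite
  once it misses \<open>D (Suc k)\<close>, but the count meets ever more such sets, and its
  constants must not depend on their parameters. Global types are not elements of the structure, so
  denying the finite cover property says nothing about them until they are coded by tuples. The
  codes come from \<open>tree_rank_ge\<close>, which is Shelah's 2-rank; they are not unique, so
  types are always compared as sets of instances. The finite cover property is then denied twice: to
  replace the finite sets in the definition of a limit point by sets of bounded size, which keeps
  each derivative definable, and to bound the number of coded types in a finite definable set.
  Isolating a point, or changing one literal of it, lengthens the list of literals by one; this is
  why each bound has to hold for all lengths \<open>r\<close> simultaneously.\<close>

primrec tree_rank_ge :: "('i \<Rightarrow> 'a set) \<Rightarrow> 'i set \<Rightarrow> nat \<Rightarrow> 'a set \<Rightarrow> bool" where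
  "tree_rank_ge H W 0 Z \<longleftrightarrow> Z \<noteq> {}"
| "tree_rank_ge H W (Suc k) Z \<longleftrightarrow>
     (\<exists>i\<in>W. tree_rank_ge H W k (Z \<inter> H i) \<and> tree_rank_ge H W k (Z - H i))"

lemma tree_rank_ge_mono: "tree_rank_ge H W k Z \<Longrightarrow> Z \<subseteq> Z' \<Longrightarrow> tree_rank_ge H W k Z'"
proof (induction k arbitrary: Z Z')
  case 0
  then show ?case by auto
next
  case (Suc k)
  then obtain i where i: "i \<in> W" "tree_rank_ge H W k (Z \<inter> H i)" "tree_rank_ge H W k (Z - H i)"
    by auto
  have "tree_rank_ge H W k (Z' \<inter> H i)" "tree_rank_ge H W k (Z' - H i)"
    by (rule Suc.IH[OF i(2)], use Suc.prems in blast) (rule Suc.IH[OF i(3)], use Suc.prems in blast)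
  then show ?case using i(1) by auto
qed

lemma tree_rank_ge_nonempty: "tree_rank_ge H W k Z \<Longrightarrow> Z \<noteq> {}"
  by (induction k arbitrary: Z) auto

text \<open>Pigeonhole for trees with labels of two colours. If the root has a label in
  \<open>W1\<close>, then by induction either both subtrees contain \<open>W1\<close>-trees of
  height \<open>h1 - 1\<close>, which the root joins, or one of them already contains a
  \<open>W2\<close>-tree of height \<open>h2\<close>.\<close>

lemma tree_rank_ge_Un:
  "tree_rank_ge H (W1 \<union> W2) (h1 + h2) Z \<Longrightarrow> tree_rank_ge H W1 h1 Z \<or> tree_rank_ge H W2 h2 Z"
proof (induction "h1 + h2" arbitrary: h1 h2 Z)
  case 0
  then show ?case by auto
next
  case (Suc k)
  from Suc.hyps(2)[symmetric] Suc.prems obtain i where i: "i \<in> W1 \<union> W2"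
    and l: "tree_rank_ge H (W1 \<union> W2) k (Z \<inter> H i)" and r: "tree_rank_ge H (W1 \<union> W2) k (Z - H i)"
    by auto
  have ne: "Z \<noteq> {}" using tree_rank_ge_nonempty[OF l] by auto
  have sub: "Z \<inter> H i \<subseteq> Z" "Z - H i \<subseteq> Z" by auto
  show ?case
  proof (cases "h1 = 0 \<or> h2 = 0")
    case True
    then show ?thesis using ne by auto
  next
    case False
    then obtain g1 g2 where g: "h1 = Suc g1" "h2 = Suc g2" by (metis not0_implies_Suc)
    then have k: "k = g1 + h2" "k = h1 + g2" using Suc.hyps(2) by auto
    show ?thesis
    proof (cases "i \<in> W1")
      case True
      show ?thesis
        using Suc.hyps(1)[OF k(1) l[unfolded k(1)]] Suc.hyps(1)[OF k(1) r[unfolded k(1)]] True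
          tree_rank_ge_mono[OF _ sub(1)] tree_rank_ge_mono[OF _ sub(2)]
        unfolding g(1) tree_rank_ge.simps(2)[of H W1] by blast
    next
      case False
      with i have "i \<in> W2" by auto
      then show ?thesis
        using Suc.hyps(1)[OF k(2) l[unfolded k(2)]] Suc.hyps(1)[OF k(2) r[unfolded k(2)]]
          tree_rank_ge_mono[OF _ sub(1)] tree_rank_ge_mono[OF _ sub(2)]
        unfolding g(2) tree_rank_ge.simps(2)[of H W2] by blast
    qed
  qed
qed

text \<open>The heights that fail for the single members add up to a height that fails for the
  union. This reduces trees for a finite \<Delta> to trees for one formula.\<close>

lemma tree_rank_ge_finite_Union:
  assumes "finite A" "\<And>h. tree_rank_ge H (\<Union>\<phi>\<in>A. W \<phi>) h Z"
  shows "\<exists>\<phi>\<in>A. \<forall>h. tree_rank_ge H (W \<phi>) h Z"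
proof (rule ccontr)
  assume "\<not> ?thesis"
  then obtain h where h: "\<And>\<phi>. \<phi> \<in> A \<Longrightarrow> \<not> tree_rank_ge H (W \<phi>) (h \<phi>) Z" by metis
  \<comment> \<open>The \<open>Suc\<close> is there for \<open>A' = {}\<close>: without labels a
    tree of height 0 may exist, but none of height 1.\<close>
  have "\<not> tree_rank_ge H (\<Union>\<phi>\<in>A'. W \<phi>) (Suc (\<Sum>\<phi>\<in>A'. h \<phi>)) Z" if "A' \<subseteq> A" for A'
    using finite_subset[OF that assms(1)] that
  proof (induction A' rule: finite_induct)
    case empty
    then show ?case by simp
  next
    case (insert \<phi> A')
    then show ?case
      using tree_rank_ge_Un[of H "W \<phi>" "\<Union> (W ` A')" "h \<phi>" "Suc (sum h A')" Z] h[of \<phi>] by auto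
  qed
  then show False using assms(2) by blast
qed

text \<open>Hodges' argument: pick a leaf \<open>a\<close>, pass to a subtree of half the height on whose nodes \<open>a\<close>
  has constant truth value, and continue on that side of its root which disagrees with \<open>a\<close>.\<close>

lemma tree_rank_ge_imp_ladder:
  "\<exists>h. \<forall>W Z. tree_rank_ge H W h Z \<longrightarrow>
     (\<exists>a c. (\<forall>i<N. a i \<in> Z \<and> c i \<in> W) \<and>
        (\<forall>i<N. \<forall>j<N. i \<noteq> j \<longrightarrow> (a i \<in> H (c j) \<longleftrightarrow> i < (j::nat))))"
proof (induction N)
  case 0
  then show ?case by auto
next
  case (Suc N)
  then obtain h where h: "\<And>W Z. tree_rank_ge H W h Z \<Longrightarrow>
     (\<exists>a c. (\<forall>i<N. a i \<in> Z \<and> c i \<in> W) \<and>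
        (\<forall>i<N. \<forall>j<N. i \<noteq> j \<longrightarrow> (a i \<in> H (c j) \<longleftrightarrow> i < (j::nat))))" by blast
  show ?case
  proof (rule exI[of _ "Suc h + Suc h"], intro allI impI)
    fix W Z assume t: "tree_rank_ge H W (Suc h + Suc h) Z"
    then obtain a0 where a0: "a0 \<in> Z" using tree_rank_ge_nonempty by blast
    define W1 W2 where "W1 = {c \<in> W. a0 \<in> H c}" and "W2 = {c \<in> W. a0 \<notin> H c}"
    have "W = W1 \<union> W2" unfolding W1_def W2_def by auto
    with t have "tree_rank_ge H W1 (Suc h) Z \<or> tree_rank_ge H W2 (Suc h) Z"
      using tree_rank_ge_Un by blast
    then show "\<exists>a c. (\<forall>i<Suc N. a i \<in> Z \<and> c i \<in> W) \<and>
        (\<forall>i<Suc N. \<forall>j<Suc N. i \<noteq> j \<longrightarrow> (a i \<in> H (c j) \<longleftrightarrow> i < (j::nat)))"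
    proof
      assume "tree_rank_ge H W1 (Suc h) Z"
      then obtain c0 where c0: "c0 \<in> W1" and "tree_rank_ge H W1 h (Z - H c0)" by auto
      from h[OF this(2)] obtain a c where ac: "\<forall>i<N. a i \<in> Z - H c0 \<and> c i \<in> W1"
        "\<forall>i<N. \<forall>j<N. i \<noteq> j \<longrightarrow> (a i \<in> H (c j) \<longleftrightarrow> i < (j::nat))" by blast
      show ?thesis
        \<comment> \<open>\<open>a0\<close> lies in \<open>H c\<close> for all labels in
          \<open>W1\<close>, and the other points avoid \<open>H c0\<close>, so the new pair goes to
          the front.\<close>
        by (rule exI[of _ "case_nat a0 a"], rule exI[of _ "case_nat c0 c"])
          (use a0 c0 ac in \<open>auto simp: W1_def split: nat.splits\<close>)
    next
      assume "tree_rank_ge H W2 (Suc h) Z"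
      then obtain c0 where c0: "c0 \<in> W2" and "tree_rank_ge H W2 h (Z \<inter> H c0)" by auto
      from h[OF this(2)] obtain a c where ac: "\<forall>i<N. a i \<in> Z \<inter> H c0 \<and> c i \<in> W2"
        "\<forall>i<N. \<forall>j<N. i \<noteq> j \<longrightarrow> (a i \<in> H (c j) \<longleftrightarrow> i < (j::nat))" by blast
      show ?thesis
        \<comment> \<open>\<open>a0\<close> avoids \<open>H c\<close> for all labels in
          \<open>W2\<close>, and the other points lie in \<open>H c0\<close>, so the new pair goes
          to the end. The two cases give opposite values on the diagonal, which is therefore left
          unspecified.\<close>
        by (rule exI[of _ "a(N := a0)"], rule exI[of _ "c(N := c0)"])
          (use a0 c0 ac in \<open>auto simp: W2_def less_Suc_eq\<close>)
    qed
  qed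
qed

text \<open>A recursion on shrinking sets instead of a quantifier over sequences: each level costs
  one quantifier, so definability follows by induction, and a chain can be prolonged one element at
  a time.\<close>

primrec chain_of_length :: "('a \<Rightarrow> 'a \<Rightarrow> bool) \<Rightarrow> nat \<Rightarrow> 'a set \<Rightarrow> bool" where
  "chain_of_length G 0 U \<longleftrightarrow> True"
| "chain_of_length G (Suc N) U \<longleftrightarrow> (\<exists>v\<in>U. chain_of_length G N (U \<inter> {w. G v w}))"

lemma chain_of_lengthI:
  assumes "\<And>i. i < N \<Longrightarrow> v i \<in> U" "\<And>i j. i < j \<Longrightarrow> j < N \<Longrightarrow> G (v i) (v j)"
  shows "chain_of_length G N U"
  using assms
proof (induction N arbitrary: U v)
  case 0
  then show ?case by simp
next
  case (Suc N)
  have "chain_of_length G N (U \<inter> {w. G (v 0) w})"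
    by (rule Suc.IH[of "v \<circ> Suc"]) (use Suc.prems in auto)
  then show ?case using Suc.prems(1)[of 0] by auto
qed

lemma chain_of_length_antimono:
  "chain_of_length G N U \<Longrightarrow> N' \<le> N \<Longrightarrow> chain_of_length G N' U"
proof (induction N arbitrary: N' U)
  case (Suc N)
  then show ?case by (cases N') auto
qed simp

section \<open>Counting traces of types\<close>

text \<open>Sets are points of the Cantor cube, which is compact by Tychonoff; a basic neighbourhood
  of a point fixes finitely many coordinates. The limit \<open>P\<close> need not belong to
  \<open>Q\<close>.\<close>

lemma infinite_imp_accumulation:
  fixes Q :: "'i set set"
  assumes "infinite Q"
  obtains P where "\<And>F. finite F \<Longrightarrow> \<exists>P'\<in>Q. P' \<noteq> P \<and> P' \<inter> F = P \<inter> F"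
proof -
  let ?T = "product_topology (\<lambda>_::'i. discrete_topology (UNIV::bool set)) UNIV"
  define S where "S = (\<lambda>P i. i \<in> P) ` Q"
  have "inj (\<lambda>P i. (i::'i) \<in> P)" by (auto simp: inj_def fun_eq_iff)
  then have "infinite S" unfolding S_def using assms
    by (meson finite_imageD inj_on_subset subset_UNIV)
  moreover have "compact_space ?T"
    by (simp add: compact_space_product_topology compact_space_discrete_topology)
  moreover have "S \<subseteq> topspace ?T" by (simp add: S_def)
  ultimately have "?T derived_set_of S \<noteq> {}"
    by (metis compact_space_imp_Bolzano_Weierstrass)
  then obtain f where f: "f \<in> ?T derived_set_of S" by auto
  show ?thesis
  proof (rule that[of "{i. f i}"])
    fix F :: "'i set" assume F: "finite F"
    define A where "A = (\<Pi>\<^sub>E i\<in>UNIV. if i \<in> F then {f i} else UNIV)"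
    have "openin ?T A"
      unfolding A_def
      by (rule product_topology_basis) (auto intro: finite_subset[OF _ F])
    moreover have "f \<in> A" by (auto simp: A_def)
    ultimately obtain g where "g \<noteq> f" "g \<in> S" "g \<in> A"
      using f unfolding in_derived_set_of by blast
    then obtain P' where P': "P' \<in> Q" "g = (\<lambda>i. i \<in> P')" by (auto simp: S_def)
    have "P' \<noteq> {i. f i}" using \<open>g \<noteq> f\<close> P' by auto
    moreover have "P' \<inter> F = {i. f i} \<inter> F"
      using \<open>g \<in> A\<close> P' by (auto simp: A_def PiE_def Pi_def split: if_splits)
    ultimately show "\<exists>P'\<in>Q. P' \<noteq> {i. f i} \<and> P' \<inter> F = {i. f i} \<inter> F" using P'(1) by blast
  qed
qed

text \<open>A basic clopen set of the cube. Lists are used because those of a fixed length are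
  parametrised by tuples of parameters.\<close>

definition fits :: "('i \<times> bool) list \<Rightarrow> 'i set set" where
  "fits ls = {P. \<forall>(i, s) \<in> set ls. i \<in> P \<longleftrightarrow> s}"

lemma fits_Nil [simp]: "fits [] = UNIV"
  by (simp add: fits_def)

lemma fits_Cons [simp]: "fits ((i, s) # ls) = {P. i \<in> P \<longleftrightarrow> s} \<inter> fits ls"
  by (auto simp: fits_def)

lemma fits_cong:
  assumes "P \<in> fits ls" "P' \<inter> fst ` set ls = P \<inter> fst ` set ls"
  shows "P' \<in> fits ls"
proof -
  have "i \<in> P' \<longleftrightarrow> s" if "(i, s) \<in> set ls" for i s
  proof -
    have "i \<in> fst ` set ls" using that by force
    then have "i \<in> P' \<longleftrightarrow> i \<in> P" using assms(2) by blast
    also have "\<dots> \<longleftrightarrow> s" using assms(1) that by (auto simp: fits_def)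
    finally show ?thesis .
  qed
  then show ?thesis by (auto simp: fits_def)
qed

abbreviation traces :: "'i set \<Rightarrow> 'i set set \<Rightarrow> 'i set set" where
  "traces F S \<equiv> (\<lambda>P. P \<inter> F) ` S"

lemma finite_traces: "finite F \<Longrightarrow> finite (traces F S)"
  by (rule finite_subset[of _ "Pow F"]) auto

text \<open>\<open>E\<close> stands for a derivative, \<open>S\<close> for the whole type space, and
  \<open>f\<close> bounds the traces inside sets that miss \<open>E\<close>. The induction on the
  number \<open>N\<close> of points of \<open>E\<close> runs over all \<open>r\<close>, since
  cutting a set in two adds a literal.\<close>

lemma traces_step:
  fixes f :: "nat \<Rightarrow> nat"
  assumes IH: "\<And>r. \<exists>C. \<forall>ls F. set ls \<subseteq> I \<times> UNIV \<and> length ls = r \<and> F \<subseteq> I \<and> finite F \<and>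
      fits ls \<inter> E = {} \<longrightarrow> card (traces F (fits ls \<inter> S)) \<le> C * f (card F)"
    and f: "\<And>t. 1 + t * f t \<le> (1 + t) ^ k" "\<And>t. f t \<le> (1 + t) ^ k"
    and E: "E \<subseteq> Pow I"
  shows "\<exists>C. \<forall>ls F. set ls \<subseteq> I \<times> UNIV \<and> length ls = r \<and> F \<subseteq> I \<and> finite F \<and>
      finite (fits ls \<inter> E) \<and> card (fits ls \<inter> E) \<le> N \<longrightarrow>
      card (traces F (fits ls \<inter> S)) \<le> C * (1 + card F) ^ k"
proof (induction N arbitrary: r)
  case 0
  obtain C where C: "\<And>ls F. set ls \<subseteq> I \<times> UNIV \<Longrightarrow> length ls = r \<Longrightarrow> F \<subseteq> I \<Longrightarrow> finite F \<Longrightarrow>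
      fits ls \<inter> E = {} \<Longrightarrow> card (traces F (fits ls \<inter> S)) \<le> C * f (card F)" using IH[of r] by blast
  show ?case
  proof (intro exI[of _ C] allI impI, elim conjE)
    fix ls F assume "set ls \<subseteq> I \<times> UNIV" "length ls = r" "F \<subseteq> I" "finite F"
      "finite (fits ls \<inter> E)" "card (fits ls \<inter> E) \<le> 0"
    then have "card (traces F (fits ls \<inter> S)) \<le> C * f (card F)" using C by simp
    also have "\<dots> \<le> C * (1 + card F) ^ k" using f(2) by (rule mult_le_mono2)
    finally show "card (traces F (fits ls \<inter> S)) \<le> C * (1 + card F) ^ k" .
  qed
next
  case (Suc N)
  obtain C0 where C0: "\<And>ls F. set ls \<subseteq> I \<times> UNIV \<Longrightarrow> length ls = r \<Longrightarrow> F \<subseteq> I \<Longrightarrow> finite F \<Longrightarrow>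
      finite (fits ls \<inter> E) \<Longrightarrow> card (fits ls \<inter> E) \<le> N \<Longrightarrow>
      card (traces F (fits ls \<inter> S)) \<le> C0 * (1 + card F) ^ k" using Suc[of r] by blast
  obtain C2 where C2: "\<And>ls F. set ls \<subseteq> I \<times> UNIV \<Longrightarrow> length ls = Suc r \<Longrightarrow> F \<subseteq> I \<Longrightarrow> finite F \<Longrightarrow>
      finite (fits ls \<inter> E) \<Longrightarrow> card (fits ls \<inter> E) \<le> N \<Longrightarrow>
      card (traces F (fits ls \<inter> S)) \<le> C2 * (1 + card F) ^ k" using Suc[of "Suc r"] by blast
  obtain C1 where C1: "\<And>ls F. set ls \<subseteq> I \<times> UNIV \<Longrightarrow> length ls = Suc r \<Longrightarrow> F \<subseteq> I \<Longrightarrow> finite F \<Longrightarrow>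
      fits ls \<inter> E = {} \<Longrightarrow> card (traces F (fits ls \<inter> S)) \<le> C1 * f (card F)"
    using IH[of "Suc r"] by blast
  \<comment> \<open>The three summands pay for the three cases below: at most \<open>N\<close>
    points of \<open>E\<close>, exactly one point, two points to be separated.\<close>
  let ?C = "C0 + (1 + C1) + (C2 + C2)"
  show ?case
  proof (intro exI[of _ ?C] allI impI, elim conjE)
    fix ls F assume ls: "set ls \<subseteq> I \<times> UNIV" "length ls = r" and F: "F \<subseteq> I" "finite F"
      and fin: "finite (fits ls \<inter> E)" and le: "card (fits ls \<inter> E) \<le> Suc N"
    let ?g = "(1 + card F) ^ k"
    consider "card (fits ls \<inter> E) \<le> N" | P where "fits ls \<inter> E = {P}"
      | P P' where "P \<in> fits ls \<inter> E" "P' \<in> fits ls \<inter> E" "P \<noteq> P'"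
    proof (cases "fits ls \<inter> E = {}")
      case False
      then obtain P where "P \<in> fits ls \<inter> E" by auto
      then show ?thesis using that by blast
    qed (use that in simp)
    then show "card (traces F (fits ls \<inter> S)) \<le> ?C * ?g"
    proof cases
      case 1
      have "card (traces F (fits ls \<inter> S)) \<le> C0 * ?g" using C0[OF ls F fin 1] .
      then show ?thesis by (simp only: distrib_right)
    next
      case (2 P)
      \<comment> \<open>\<open>?U i\<close> consists of the types that differ from the only point
        \<open>P\<close> at \<open>i\<close>. It misses \<open>E\<close>, so each choice of
        \<open>i\<close> costs \<open>f\<close> and the exponent grows by one.\<close>
      let ?U = "\<lambda>i. fits ((i, i \<notin> P) # ls) \<inter> S"
      have "traces F (fits ls \<inter> S) \<subseteq> insert (P \<inter> F) (\<Union>i\<in>F. traces F (?U i))"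
      proof
        fix q assume "q \<in> traces F (fits ls \<inter> S)"
        then obtain P' where P': "P' \<in> fits ls" "P' \<in> S" "q = P' \<inter> F" by auto
        show "q \<in> insert (P \<inter> F) (\<Union>i\<in>F. traces F (?U i))"
        proof (cases "P' \<inter> F = P \<inter> F")
          case False
          then obtain i where "i \<in> F" "i \<in> P' \<longleftrightarrow> i \<notin> P" by blast
          then show ?thesis using P' by auto
        qed (use P' in simp)
      qed
      then have "card (traces F (fits ls \<inter> S)) \<le> card (insert (P \<inter> F) (\<Union>i\<in>F. traces F (?U i)))"
        using F by (intro card_mono) (auto intro: finite_traces)
      also have "\<dots> \<le> 1 + card (\<Union>i\<in>F. traces F (?U i))"
        using card_insert_le_m1 by (simp add: card_insert_if F finite_traces)
      also have "\<dots> \<le> 1 + (\<Sum>i\<in>F. card (traces F (?U i)))"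
        using card_UN_le[OF F(2)] by simp
      also have "\<dots> \<le> 1 + (\<Sum>i\<in>F. C1 * f (card F))"
      proof -
        have "card (traces F (?U i)) \<le> C1 * f (card F)" if i: "i \<in> F" for i
        proof (rule C1)
          show "fits ((i, i \<notin> P) # ls) \<inter> E = {}" using 2 by auto
        qed (use ls F i in auto)
        then show ?thesis by (meson add_left_mono sum_mono)
      qed
      also have "\<dots> = 1 + C1 * (card F * f (card F))" by simp
      also have "\<dots> \<le> (1 + C1) * (1 + card F * f (card F))" by simp
      also have "\<dots> \<le> (1 + C1) * ?g" using f(1) by (rule mult_le_mono2)
      also have "\<dots> \<le> ?C * ?g" by (rule mult_le_mono1) simp
      finally show ?thesis .
    next
      case (3 P P')
      \<comment> \<open>Cutting at an instance where the two points differ removes a point of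
        \<open>E\<close> from either side.\<close>
      then obtain i where i: "i \<in> P \<longleftrightarrow> i \<notin> P'" by blast
      then have iI: "i \<in> I" using 3 E by blast
      have *: "card (traces F (fits ((i, s) # ls) \<inter> S)) \<le> C2 * ?g" for s
      proof (rule C2)
        have "fits ((i, s) # ls) \<inter> E \<subset> fits ls \<inter> E" using 3 i by auto
        then show "finite (fits ((i, s) # ls) \<inter> E)" "card (fits ((i, s) # ls) \<inter> E) \<le> N"
          using le fin psubset_card_mono[OF fin] finite_subset
          by (blast, metis less_Suc_eq_le order_less_le_trans)
      qed (use ls F iI in auto)
      have "traces F (fits ls \<inter> S) \<subseteq>
          traces F (fits ((i, True) # ls) \<inter> S) \<union> traces F (fits ((i, False) # ls) \<inter> S)"
        by auto
      then have "card (traces F (fits ls \<inter> S)) \<le>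
          card (traces F (fits ((i, True) # ls) \<inter> S) \<union> traces F (fits ((i, False) # ls) \<inter> S))"
        using F by (intro card_mono) (auto intro: finite_traces)
      also have "\<dots> \<le> C2 * ?g + C2 * ?g"
        using *[of True] *[of False] by (meson add_mono card_Un_le order_trans)
      also have "\<dots> \<le> ?C * ?g" by (simp only: distrib_right)
      finally show ?thesis .
    qed
  qed
qed

text \<open>A set that misses \<open>D k\<close> meets only the derivatives below \<open>k\<close>,
  hence the exponent \<open>k - 1\<close>; one that misses \<open>D 0\<close> has nothing to count,
  hence the separate value 0. The base \<open>1 + card F\<close> leaves room for the one trace of
  the isolated point in the recursion.\<close>

lemma card_traces_le:
  fixes D :: "nat \<Rightarrow> 'i set set"
  assumes bdd: "\<And>k r. \<exists>N. \<forall>ls. set ls \<subseteq> I \<times> UNIV \<and> length ls = r \<and> fits ls \<inter> D (Suc k) = {} \<longrightarrow>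
      finite (fits ls \<inter> D k) \<and> card (fits ls \<inter> D k) \<le> N"
    and sub: "\<And>k. D k \<subseteq> Pow I"
  shows "\<exists>C. \<forall>ls F. set ls \<subseteq> I \<times> UNIV \<and> length ls = r \<and> F \<subseteq> I \<and> finite F \<and> fits ls \<inter> D k = {} \<longrightarrow>
      card (traces F (fits ls \<inter> D 0)) \<le> C * (if k = 0 then 0 else (1 + card F) ^ (k - 1))"
proof (induction k arbitrary: r)
  case 0
  then show ?case by auto
next
  case (Suc k)
  obtain N where N: "\<And>ls. set ls \<subseteq> I \<times> UNIV \<Longrightarrow> length ls = r \<Longrightarrow> fits ls \<inter> D (Suc k) = {} \<Longrightarrow>
      finite (fits ls \<inter> D k) \<and> card (fits ls \<inter> D k) \<le> N" using bdd[of r k] by blast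
  have "1 + t * (if k = 0 then 0 else (1 + t) ^ (k - 1)) \<le> (1 + t) ^ k" for t :: nat
    by (cases k) auto
  moreover have "(if k = 0 then 0 else (1 + t) ^ (k - 1)) \<le> (1 + t) ^ k" for t :: nat
    by (cases k) auto
  ultimately have "\<exists>C. \<forall>ls F. set ls \<subseteq> I \<times> UNIV \<and> length ls = r \<and> F \<subseteq> I \<and> finite F \<and>
      finite (fits ls \<inter> D k) \<and> card (fits ls \<inter> D k) \<le> N \<longrightarrow>
      card (traces F (fits ls \<inter> D 0)) \<le> C * (1 + card F) ^ k"
    by (rule traces_step[where f = "\<lambda>t. if k = 0 then 0 else (1 + t) ^ (k - 1)", OF Suc _ _ sub])
  then show ?case using N by (simp; blast)
qed

section \<open>Definable sets\<close>

primrec rename_trm :: "(nat \<Rightarrow> nat) \<Rightarrow> 'f trm \<Rightarrow> 'f trm" where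
  "rename_trm g (Var i) = Var (g i)"
| "rename_trm g (Fun f ts) = Fun f (map (rename_trm g) ts)"

primrec rename_fm :: "(nat \<Rightarrow> nat) \<Rightarrow> ('f, 'r) fm \<Rightarrow> ('f, 'r) fm" where
  "rename_fm g (Eq s t) = Eq (rename_trm g s) (rename_trm g t)"
| "rename_fm g (Rel r ts) = Rel r (map (rename_trm g) ts)"
| "rename_fm g (Neg \<phi>) = Neg (rename_fm g \<phi>)"
| "rename_fm g (Conj \<phi> \<psi>) = Conj (rename_fm g \<phi>) (rename_fm g \<psi>)"
| "rename_fm g (Ex \<phi>) = Ex (rename_fm (case_nat 0 (Suc \<circ> g)) \<phi>)"

lemma eval_rename_trm: "eval_trm M e (rename_trm g t) = eval_trm M (\<lambda>i. e (g i)) t"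
proof (induction t)
  case (Fun f ts)
  then have "map (eval_trm M e \<circ> rename_trm g) ts = map (eval_trm M (\<lambda>i. e (g i))) ts" by auto
  then show ?case by (simp only: rename_trm.simps eval_trm.simps map_map)
qed simp

lemma vars_rename_trm: "vars_trm (rename_trm g t) = g ` vars_trm t"
  by (induction t) auto

lemma funs_rename_trm: "funs_trm (rename_trm g t) = funs_trm t"
  by (induction t) auto

lemma sat_rename_fm: "sat M e (rename_fm g \<phi>) \<longleftrightarrow> sat M (\<lambda>i. e (g i)) \<phi>"
proof (induction \<phi> arbitrary: e g)
  case (Rel r ts)
  have "map (eval_trm M e \<circ> rename_trm g) ts = map (eval_trm M (\<lambda>i. e (g i))) ts"
    by (simp add: eval_rename_trm)
  then show ?case by (simp only: rename_fm.simps sat.simps map_map)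
next
  case (Ex \<phi>)
  have "(\<lambda>i. case_nat d e (case_nat 0 (Suc \<circ> g) i)) = case_nat d (\<lambda>i. e (g i))" for d
    by (auto simp: fun_eq_iff split: nat.splits)
  then show ?case using Ex by simp
qed (auto simp: eval_rename_trm)

lemma free_vars_rename_fm: "free_vars (rename_fm g \<phi>) \<subseteq> g ` free_vars \<phi>"
proof (induction \<phi> arbitrary: g)
  case (Ex \<phi>)
  show ?case
  proof
    fix i assume "i \<in> free_vars (rename_fm g (Ex \<phi>))"
    then have "Suc i \<in> case_nat 0 (Suc \<circ> g) ` free_vars \<phi>" using Ex by auto
    then obtain j where "j \<in> free_vars \<phi>" "Suc i = case_nat 0 (Suc \<circ> g) j" by auto
    then show "i \<in> g ` free_vars (Ex \<phi>)" by (cases j) auto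
  qed
next
  case (Conj \<phi> \<psi>)
  then show ?case unfolding rename_fm.simps free_vars.simps image_Un by blast
qed (auto simp: vars_rename_trm)

lemma rename_fm_formulas: "\<phi> \<in> formulas L \<Longrightarrow> rename_fm g \<phi> \<in> formulas L"
proof -
  have "funs_fm (rename_fm g \<phi>) = funs_fm \<phi>" "rels_fm (rename_fm g \<phi>) = rels_fm \<phi>"
    by (induction \<phi> arbitrary: g) (auto simp: funs_rename_trm)
  then show "\<phi> \<in> formulas L \<Longrightarrow> rename_fm g \<phi> \<in> formulas L" by (simp add: formulas_def)
qed

lemma eval_trm_cong: "(\<And>i. i \<in> vars_trm t \<Longrightarrow> e i = e' i) \<Longrightarrow> eval_trm M e t = eval_trm M e' t"
proof (induction t)
  case (Fun f ts)
  then have "map (eval_trm M e) ts = map (eval_trm M e') ts" by auto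
  then show ?case by (metis eval_trm.simps(2))
qed simp

lemma sat_cong: "(\<And>i. i \<in> free_vars \<phi> \<Longrightarrow> e i = e' i) \<Longrightarrow> sat M e \<phi> \<longleftrightarrow> sat M e' \<phi>"
proof (induction \<phi> arbitrary: e e')
  case (Eq s t)
  then show ?case using eval_trm_cong[of s e e' M] eval_trm_cong[of t e e' M] by auto
next
  case (Rel r ts)
  then have "map (eval_trm M e) ts = map (eval_trm M e') ts"
    by (auto intro!: eval_trm_cong)
  then show ?case by (metis sat.simps(2))
next
  case (Conj \<phi> \<psi>)
  then show ?case by (metis UnCI free_vars.simps(4) sat.simps(4))
next
  case (Ex \<phi>)
  have "sat M (case_nat d e) \<phi> \<longleftrightarrow> sat M (case_nat d e') \<phi>" for d
    by (rule Ex.IH) (use Ex.prems in \<open>auto split: nat.splits\<close>)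
  then show ?case by simp
next
  case (Neg \<phi>)
  then show ?case by (metis free_vars.simps(3) sat.simps(3))
qed

text \<open>Only lists of length \<open>K\<close> are constrained, so combinations of
  \<open>take\<close>, \<open>drop\<close> and append qualify. Substituting such maps into definable
  predicates turns definability goals into a syntax-directed search with
  \<open>coord_map_intros\<close>.\<close>

definition coord_map :: "nat \<Rightarrow> nat \<Rightarrow> ('a list \<Rightarrow> 'a list) \<Rightarrow> bool" where
  "coord_map K k f \<longleftrightarrow> (\<exists>is. length is = k \<and> set is \<subseteq> {..<K} \<and>
     (\<forall>xs. length xs = K \<longrightarrow> f xs = map ((!) xs) is))"

lemma coord_map_id: "coord_map K K (\<lambda>xs. xs)"
  unfolding coord_map_def by (rule exI[of _ "[0..<K]"]) (auto simp: map_nth)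

lemma coord_map_take: "coord_map K k f \<Longrightarrow> j \<le> k \<Longrightarrow> coord_map K j (\<lambda>xs. take j (f xs))"
  unfolding coord_map_def
proof (elim exE conjE)
  fix "is" assume "j \<le> k" "length is = k" "set is \<subseteq> {..<K}"
    "\<forall>xs. length xs = K \<longrightarrow> f xs = map ((!) xs) is"
  then show "\<exists>is. length is = j \<and> set is \<subseteq> {..<K} \<and>
      (\<forall>xs. length xs = K \<longrightarrow> take j (f xs) = map ((!) xs) is)"
    by (intro exI[of _ "take j is"]) (auto simp: take_map dest: in_set_takeD)
qed

lemma coord_map_drop: "coord_map K (j + k) f \<Longrightarrow> coord_map K k (\<lambda>xs. drop j (f xs))"
  unfolding coord_map_def
proof (elim exE conjE)
  fix "is" assume "length is = j + k" "set is \<subseteq> {..<K}"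
    "\<forall>xs. length xs = K \<longrightarrow> f xs = map ((!) xs) is"
  then show "\<exists>is. length is = k \<and> set is \<subseteq> {..<K} \<and>
      (\<forall>xs. length xs = K \<longrightarrow> drop j (f xs) = map ((!) xs) is)"
    by (intro exI[of _ "drop j is"]) (auto simp: drop_map dest: in_set_dropD)
qed

lemma coord_map_append:
  "coord_map K j f \<Longrightarrow> coord_map K k g \<Longrightarrow> coord_map K (j + k) (\<lambda>xs. f xs @ g xs)"
  unfolding coord_map_def
proof (elim exE conjE)
  fix is1 is2 assume "length is1 = j" "set is1 \<subseteq> {..<K}" "length is2 = k" "set is2 \<subseteq> {..<K}"
    "\<forall>xs. length xs = K \<longrightarrow> f xs = map ((!) xs) is1"
    "\<forall>xs. length xs = K \<longrightarrow> g xs = map ((!) xs) is2"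
  then show "\<exists>is. length is = j + k \<and> set is \<subseteq> {..<K} \<and>
      (\<forall>xs. length xs = K \<longrightarrow> f xs @ g xs = map ((!) xs) is)"
    by (intro exI[of _ "is1 @ is2"]) auto
qed

lemma coord_map_nlists: "coord_map K k f \<Longrightarrow> xs \<in> nlists K A \<Longrightarrow> f xs \<in> nlists k A"
  unfolding coord_map_def nlists_def mem_Collect_eq
proof (elim exE conjE)
  fix "is" assume *: "length xs = K" "set xs \<subseteq> A" "length is = k" "set is \<subseteq> {..<K}"
    "\<forall>xs. length xs = K \<longrightarrow> f xs = map ((!) xs) is"
  then have "f xs = map ((!) xs) is" by simp
  moreover have "xs ! i \<in> A" if "i \<in> set is" for i
    using * that nth_mem by blast
  ultimately show "length (f xs) = k \<and> set (f xs) \<subseteq> A" using * by auto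
qed

text \<open>As conditional rewrite rules these two loop together with \<open>nlists_def\<close>.\<close>

declare nlistsE_set [simp del] nlistsE_length [simp del]

section \<open>Definable predicates and their closure properties\<close>

locale fo_structure =
  fixes L :: "('f, 'r) language" and M :: "('f, 'r, 'm) fo_struct"
  assumes is_struct: "is_structure L M"
begin

abbreviation tuples :: "nat \<Rightarrow> 'm list set" where
  "tuples k \<equiv> nlists k (univ M)"

lemma tuples_nonempty: "tuples k \<noteq> {}"
proof -
  obtain u where "u \<in> univ M" using is_struct by (auto simp: is_structure_def)
  then have "replicate k u \<in> tuples k" by (auto simp: nlists_def)
  then show ?thesis by blast
qed

lemma append_tuples: "a \<in> tuples j \<Longrightarrow> b \<in> tuples k \<Longrightarrow> a @ b \<in> tuples (j + k)"
  by (auto simp: nlists_def)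

lemma take_tuples: "xs \<in> tuples (j + k) \<Longrightarrow> take j xs \<in> tuples j"
  by (auto simp: nlists_def dest: in_set_takeD)

lemma drop_tuples: "xs \<in> tuples (j + k) \<Longrightarrow> drop j xs \<in> tuples k"
  by (auto simp: nlists_def dest: in_set_dropD)

lemma take_append_tuples: "a \<in> tuples j \<Longrightarrow> take j (a @ b) = a"
  by (simp add: nlists_def)

lemma drop_append_tuples: "a \<in> tuples j \<Longrightarrow> drop j (a @ b) = b"
  by (simp add: nlists_def)

text \<open>Predicates replace formulas so that formulas need not be written out. The definitions
  are free of parameters, and values outside \<open>tuples k\<close> are irrelevant.\<close>

definition definable :: "nat \<Rightarrow> ('m list \<Rightarrow> bool) \<Rightarrow> bool" where
  "definable k Q \<longleftrightarrow> (\<exists>\<phi>\<in>formulas_in L k. \<forall>xs\<in>tuples k. Q xs \<longleftrightarrow> holds M \<phi> xs)"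

definition definable2 :: "nat \<Rightarrow> nat \<Rightarrow> ('m list \<Rightarrow> 'm list \<Rightarrow> bool) \<Rightarrow> bool" where
  "definable2 j k R \<longleftrightarrow> definable (j + k) (\<lambda>xs. R (take j xs) (drop j xs))"

lemma definable_cong:
  "definable k Q \<Longrightarrow> (\<And>xs. xs \<in> tuples k \<Longrightarrow> Q xs \<longleftrightarrow> Q' xs) \<Longrightarrow> definable k Q'"
  unfolding definable_def by blast

lemma definable2_cong:
  assumes "definable2 j k R"
    and "\<And>a b. a \<in> tuples j \<Longrightarrow> b \<in> tuples k \<Longrightarrow> R a b \<longleftrightarrow> R' a b"
  shows "definable2 j k R'"
  using assms(1) unfolding definable2_def
  by (rule definable_cong) (use assms(2) take_tuples drop_tuples in blast)

lemma definable2_formula: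
  assumes "definable2 j k R"
  obtains \<phi> where "\<phi> \<in> formulas_in L (j + k)"
    "\<And>a b. a \<in> tuples j \<Longrightarrow> b \<in> tuples k \<Longrightarrow> R a b \<longleftrightarrow> holds M \<phi> (a @ b)"
proof -
  obtain \<phi> where \<phi>: "\<phi> \<in> formulas_in L (j + k)"
    "\<And>xs. xs \<in> tuples (j + k) \<Longrightarrow> R (take j xs) (drop j xs) \<longleftrightarrow> holds M \<phi> xs"
    using assms unfolding definable2_def definable_def by blast
  show ?thesis
  proof (rule that[OF \<phi>(1)])
    fix a b assume ab: "a \<in> tuples j" "b \<in> tuples k"
    show "R a b \<longleftrightarrow> holds M \<phi> (a @ b)"
      using \<phi>(2)[OF append_tuples[OF ab]] ab(1)
        by (simp add: take_append_tuples drop_append_tuples del: take_append drop_append)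
  qed
qed

lemma definable2_holds:
  "\<phi> \<in> formulas_in L (j + k) \<Longrightarrow> definable2 j k (\<lambda>a b. holds M \<phi> (a @ b))"
  unfolding definable2_def definable_def by auto

lemma definable_not: "definable k Q \<Longrightarrow> definable k (\<lambda>xs. \<not> Q xs)"
  unfolding definable_def
proof (elim bexE)
  fix \<phi> assume "\<phi> \<in> formulas_in L k" "\<forall>xs\<in>tuples k. Q xs \<longleftrightarrow> holds M \<phi> xs"
  then show "\<exists>\<phi>\<in>formulas_in L k. \<forall>xs\<in>tuples k. (\<not> Q xs) \<longleftrightarrow> holds M \<phi> xs"
    by (intro bexI[of _ "Neg \<phi>"]) (auto simp: formulas_in_def formulas_def holds_def)
qed

lemma definable_conj: "definable k Q \<Longrightarrow> definable k Q' \<Longrightarrow> definable k (\<lambda>xs. Q xs \<and> Q' xs)"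
  unfolding definable_def
proof (elim bexE)
  fix \<phi> \<psi> assume "\<phi> \<in> formulas_in L k" "\<forall>xs\<in>tuples k. Q xs \<longleftrightarrow> holds M \<phi> xs"
    "\<psi> \<in> formulas_in L k" "\<forall>xs\<in>tuples k. Q' xs \<longleftrightarrow> holds M \<psi> xs"
  then show "\<exists>\<phi>\<in>formulas_in L k. \<forall>xs\<in>tuples k. (Q xs \<and> Q' xs) \<longleftrightarrow> holds M \<phi> xs"
    by (intro bexI[of _ "Conj \<phi> \<psi>"]) (auto simp: formulas_in_def formulas_def holds_def)
qed

lemma definable_True: "definable k (\<lambda>xs. True)"
proof -
  obtain u where "u \<in> univ M" using is_struct by (auto simp: is_structure_def)
  then show ?thesis unfolding definable_def
    \<comment> \<open>The witness is a sentence because for \<open>k = 0\<close> no free variable is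
      allowed.\<close>
    by (intro bexI[of _ "Ex (Eq (Var 0) (Var 0))"])
      (auto simp: formulas_in_def formulas_def holds_def)
qed

lemma definable_const: "definable k (\<lambda>xs. P)"
  using definable_True definable_not[OF definable_True] by (cases P) simp_all

lemma definable_disj: "definable k Q \<Longrightarrow> definable k Q' \<Longrightarrow> definable k (\<lambda>xs. Q xs \<or> Q' xs)"
  using definable_not[OF definable_conj[OF definable_not definable_not, of k Q Q']] by simp

lemma definable_iff: "definable k Q \<Longrightarrow> definable k Q' \<Longrightarrow> definable k (\<lambda>xs. Q xs \<longleftrightarrow> Q' xs)"
proof -
  assume "definable k Q" "definable k Q'"
  then have "definable k (\<lambda>xs. (Q xs \<and> Q' xs) \<or> (\<not> Q xs \<and> \<not> Q' xs))"
    by (intro definable_disj definable_conj definable_not)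
  then show ?thesis by (rule definable_cong) auto
qed

lemma definable_finite_ball:
  "finite A \<Longrightarrow> (\<And>i. i \<in> A \<Longrightarrow> definable k (Q i)) \<Longrightarrow> definable k (\<lambda>xs. \<forall>i\<in>A. Q i xs)"
  by (induction A rule: finite_induct) (auto intro: definable_const definable_conj)

lemma definable_finite_bex:
  "finite A \<Longrightarrow> (\<And>i. i \<in> A \<Longrightarrow> definable k (Q i)) \<Longrightarrow> definable k (\<lambda>xs. \<exists>i\<in>A. Q i xs)"
  by (induction A rule: finite_induct) (auto intro: definable_const definable_disj)

lemma definable_comp:
  assumes "definable k Q" "coord_map K k f"
  shows "definable K (\<lambda>xs. Q (f xs))"
proof -
  obtain \<phi> where \<phi>: "\<phi> \<in> formulas_in L k" "\<And>xs. xs \<in> tuples k \<Longrightarrow> Q xs \<longleftrightarrow> holds M \<phi> xs"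
    using assms(1) unfolding definable_def by blast
  obtain "is" where "is": "length is = k" "set is \<subseteq> {..<K}"
    "\<And>xs. length xs = K \<Longrightarrow> f xs = map ((!) xs) is"
    using assms(2) unfolding coord_map_def by blast
  have fv: "free_vars \<phi> \<subseteq> {..<k}" and fm: "\<phi> \<in> formulas L"
    using \<phi>(1) by (auto simp: formulas_in_def)
  let ?\<psi> = "rename_fm ((!) is) \<phi>"
  have "free_vars ?\<psi> \<subseteq> {..<K}"
  proof
    fix i assume "i \<in> free_vars ?\<psi>"
    then obtain j where j: "j \<in> free_vars \<phi>" "i = is ! j" using free_vars_rename_fm by blast
    then have "j < length is" using fv "is"(1) by auto
    then show "i \<in> {..<K}" using "is"(2) nth_mem j(2) by blast
  qed
  then have "?\<psi> \<in> formulas_in L K" using rename_fm_formulas[OF fm] by (simp add: formulas_in_def)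
  moreover have "Q (f xs) \<longleftrightarrow> holds M ?\<psi> xs" if xs: "xs \<in> tuples K" for xs
  proof -
    have "f xs = map ((!) xs) is" using "is"(3) xs by (simp add: nlists_def)
    then have "Q (f xs) \<longleftrightarrow> sat M (\<lambda>i. map ((!) xs) is ! i) \<phi>"
      using \<phi>(2)[OF coord_map_nlists[OF assms(2) xs]] by (simp add: holds_def)
    also have "\<dots> \<longleftrightarrow> sat M (\<lambda>i. xs ! (is ! i)) \<phi>"
      by (rule sat_cong) (use fv "is"(1) in auto)
    also have "\<dots> \<longleftrightarrow> holds M ?\<psi> xs" by (simp add: holds_def sat_rename_fm)
    finally show ?thesis .
  qed
  ultimately show ?thesis unfolding definable_def by blast
qed

lemma definable2_comp:
  assumes "definable2 j k R" "coord_map K j f" "coord_map K k g"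
  shows "definable K (\<lambda>xs. R (f xs) (g xs))"
proof -
  have "definable K (\<lambda>xs. R (take j (f xs @ g xs)) (drop j (f xs @ g xs)))"
    using definable_comp[OF assms(1)[unfolded definable2_def] coord_map_append[OF assms(2,3)]] .
  then show ?thesis
  proof (rule definable_cong)
    fix xs assume "xs \<in> tuples K"
    then have "f xs \<in> tuples j" using assms(2) coord_map_nlists by blast
    then show "R (take j (f xs @ g xs)) (drop j (f xs @ g xs)) \<longleftrightarrow> R (f xs) (g xs)"
      by (simp add: take_append_tuples drop_append_tuples del: take_append drop_append)
  qed
qed

lemma definable_ex1: "definable (Suc k) Q \<Longrightarrow> definable k (\<lambda>xs. \<exists>d\<in>univ M. Q (d # xs))"
  unfolding definable_def
proof (elim bexE)
  fix \<phi> assume \<phi>: "\<phi> \<in> formulas_in L (Suc k)" "\<forall>xs\<in>tuples (Suc k). Q xs \<longleftrightarrow> holds M \<phi> xs"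
  have "case_nat d ((!) xs) = (!) (d # xs)" for d :: 'm and xs
    by (auto simp: fun_eq_iff split: nat.splits)
  moreover have "Ex \<phi> \<in> formulas_in L k" using \<phi>(1) by (auto simp: formulas_in_def formulas_def)
  ultimately show "\<exists>\<phi>\<in>formulas_in L k. \<forall>xs\<in>tuples k. (\<exists>d\<in>univ M. Q (d # xs)) \<longleftrightarrow> holds M \<phi> xs"
    using \<phi>(2) by (intro bexI[of _ "Ex \<phi>"]) (auto simp: holds_def)
qed

lemma definable_ex_append: "definable (j + k) Q \<Longrightarrow> definable k (\<lambda>xs. \<exists>b\<in>tuples j. Q (b @ xs))"
proof (induction j arbitrary: Q)
  case 0
  then show ?case by simp
next
  case (Suc j)
  have "definable k (\<lambda>xs. \<exists>b\<in>tuples j. \<exists>d\<in>univ M. Q (d # b @ xs))"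
    using Suc.IH[OF definable_ex1[of "j + k" Q]] Suc.prems by simp
  then show ?case
  proof (rule definable_cong)
    fix xs
    show "(\<exists>b\<in>tuples j. \<exists>d\<in>univ M. Q (d # b @ xs)) \<longleftrightarrow> (\<exists>b\<in>tuples (Suc j). Q (b @ xs))"
    proof
      assume "\<exists>b\<in>tuples j. \<exists>d\<in>univ M. Q (d # b @ xs)"
      then obtain b d where bd: "b \<in> tuples j" "d \<in> univ M" "Q (d # b @ xs)" by blast
      then have "d # b \<in> tuples (Suc j)" by (auto simp: nlists_def)
      then show "\<exists>b\<in>tuples (Suc j). Q (b @ xs)" using bd(3) by (metis append_Cons)
    next
      assume "\<exists>b\<in>tuples (Suc j). Q (b @ xs)"
      then obtain b where b: "b \<in> tuples (Suc j)" "Q (b @ xs)" by blast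
      then obtain d b' where "b = d # b'" by (cases b) (auto simp: nlists_def)
      with b show "\<exists>b\<in>tuples j. \<exists>d\<in>univ M. Q (d # b @ xs)" by (auto simp: nlists_def)
    qed
  qed
qed

text \<open>The quantified block stands in front because \<open>Ex\<close> binds index 0.\<close>

lemma definable_ex:
  assumes "definable (j + k) (\<lambda>ys. Q (take j ys) (drop j ys))"
  shows "definable k (\<lambda>xs. \<exists>b\<in>tuples j. Q b xs)"
  using definable_ex_append[OF assms]
  by (rule definable_cong)
    (simp add: take_append_tuples drop_append_tuples del: take_append drop_append)

lemma definable_all:
  assumes "definable (j + k) (\<lambda>ys. Q (take j ys) (drop j ys))"
  shows "definable k (\<lambda>xs. \<forall>b\<in>tuples j. Q b xs)"
  using definable_not[OF definable_ex[of j k "\<lambda>b xs. \<not> Q b xs", OF definable_not[OF assms]]] by simp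

lemma definable_eq:
  assumes "coord_map K k f" "coord_map K k g"
  shows "definable K (\<lambda>xs. f xs = g xs)"
proof -
  obtain is1 where is1: "length is1 = k" "set is1 \<subseteq> {..<K}"
    "\<And>xs. length xs = K \<Longrightarrow> f xs = map ((!) xs) is1"
    using assms(1) unfolding coord_map_def by blast
  obtain is2 where is2: "length is2 = k" "set is2 \<subseteq> {..<K}"
    "\<And>xs. length xs = K \<Longrightarrow> g xs = map ((!) xs) is2"
    using assms(2) unfolding coord_map_def by blast
  have "definable K (\<lambda>xs. xs ! (is1 ! i) = xs ! (is2 ! i))" if "i \<in> {..<k}" for i
  proof -
    have "is1 ! i \<in> set is1" "is2 ! i \<in> set is2" using that is1(1) is2(1) by auto
    then have "is1 ! i < K" "is2 ! i < K" using is1(2) is2(2) by auto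
    then show ?thesis unfolding definable_def
      by (intro bexI[of _ "Eq (Var (is1 ! i)) (Var (is2 ! i))"])
        (auto simp: formulas_in_def formulas_def holds_def)
  qed
  then have "definable K (\<lambda>xs. \<forall>i\<in>{..<k}. xs ! (is1 ! i) = xs ! (is2 ! i))"
    by (intro definable_finite_ball) auto
  then show ?thesis
  proof (rule definable_cong)
    fix xs assume "xs \<in> tuples K"
    then have "f xs = map ((!) xs) is1" "g xs = map ((!) xs) is2"
      using is1 is2 by (auto simp: nlists_def)
    then show "(\<forall>i\<in>{..<k}. xs ! (is1 ! i) = xs ! (is2 ! i)) \<longleftrightarrow> f xs = g xs"
      using is1(1) is2(1) by (auto simp: list_eq_iff_nth_eq)
  qed
qed

lemmas coord_map_intros = coord_map_id coord_map_take coord_map_drop coord_map_append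

section \<open>Definable properties of definable sets\<close>

text \<open>The property \<Theta> is definable uniformly in families: whether a member satisfies it
  is a first-order condition on the parameter of that member.\<close>

definition definable_op :: "nat \<Rightarrow> ('m list set \<Rightarrow> bool) \<Rightarrow> bool" where
  "definable_op m \<Theta> \<longleftrightarrow>
     (\<forall>k R. definable2 m k R \<longrightarrow> definable k (\<lambda>c. \<Theta> {a \<in> tuples m. R a c}))"

lemma definable_op_cong:
  "definable_op m \<Theta> \<Longrightarrow> (\<And>U. U \<subseteq> tuples m \<Longrightarrow> \<Theta> U \<longleftrightarrow> \<Theta>' U) \<Longrightarrow> definable_op m \<Theta>'"
  unfolding definable_op_def by simp

lemma definable_op_const: "definable_op m (\<lambda>U. P)"
  unfolding definable_op_def by (simp add: definable_const)

lemma definable_op_nonempty: "definable_op m (\<lambda>U. U \<noteq> {})"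
  unfolding definable_op_def
proof (intro allI impI)
  fix k R assume "definable2 m k R"
  then have "definable k (\<lambda>c. \<exists>a\<in>tuples m. R a c)"
    unfolding definable2_def by (rule definable_ex)
  then show "definable k (\<lambda>c. {a \<in> tuples m. R a c} \<noteq> {})"
    by (rule definable_cong) auto
qed

lemma definable_op_finite_bex:
  "finite A \<Longrightarrow> (\<And>i. i \<in> A \<Longrightarrow> definable_op m (\<Theta> i)) \<Longrightarrow> definable_op m (\<lambda>U. \<exists>i\<in>A. \<Theta> i U)"
  unfolding definable_op_def by (intro allI impI definable_finite_bex) auto

text \<open>One level of a recursion that chooses a parameter and imposes conditions on two pieces.
  Both the tree rank and the chains have this form.\<close>

lemma definable_op_split:
  assumes "definable_op m \<Theta>1" "definable_op m \<Theta>2" "definable2 m n R1" "definable2 m n R2"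
  shows "definable_op m (\<lambda>U. \<exists>b\<in>tuples n. \<Theta>1 (U \<inter> {a. R1 a b}) \<and> \<Theta>2 (U \<inter> {a. R2 a b}))"
  unfolding definable_op_def
proof (intro allI impI)
  fix k R assume R: "definable2 m k R"
  have *: "definable (n + k) (\<lambda>d. \<Theta> ({a \<in> tuples m. R a (drop n d)} \<inter> {a. R' a (take n d)}))"
    if "definable_op m \<Theta>" and R': "definable2 m n R'" for \<Theta> R'
  proof -
    have "definable2 m (n + k) (\<lambda>a d. R a (drop n d) \<and> R' a (take n d))"
      unfolding definable2_def
      by (rule definable_conj definable2_comp[OF R] definable2_comp[OF R']
        coord_map_intros | simp)+
    then have "definable (n + k) (\<lambda>d. \<Theta> {a \<in> tuples m. R a (drop n d) \<and> R' a (take n d)})"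
      using that(1) unfolding definable_op_def by blast
    moreover have "{a \<in> tuples m. R a (drop n d) \<and> R' a (take n d)} =
        {a \<in> tuples m. R a (drop n d)} \<inter> {a. R' a (take n d)}" for d by auto
    ultimately show ?thesis by simp
  qed
  show "definable k (\<lambda>c. \<exists>b\<in>tuples n. \<Theta>1 ({a \<in> tuples m. R a c} \<inter> {a. R1 a b}) \<and>
      \<Theta>2 ({a \<in> tuples m. R a c} \<inter> {a. R2 a b}))"
    by (intro definable_ex definable_conj *[OF assms(1,3)] *[OF assms(2,4)])
qed

abbreviation solutions :: "('f, 'r, 'm) pfm \<Rightarrow> 'm list set" where
  "solutions i \<equiv> {a. holds M (fst i) (a @ snd i)}"

lemma definable2_not: "definable2 j k R \<Longrightarrow> definable2 j k (\<lambda>a b. \<not> R a b)"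
  unfolding definable2_def by (rule definable_not)

text \<open>For a fixed height the choice of a label is a finite disjunction over \<Delta> followed
  by a quantifier over parameter tuples.\<close>

lemma definable_op_tree_rank_ge:
  assumes "finite \<Delta>" "\<Delta> \<subseteq> formulas_in L (m + n)"
  shows "definable_op m (tree_rank_ge solutions (\<Delta> \<times> tuples n) k)"
proof (induction k)
  case 0
  then show ?case by (simp add: definable_op_nonempty)
next
  case (Suc k)
  let ?T = "tree_rank_ge solutions (\<Delta> \<times> tuples n) k"
  have "definable_op m (\<lambda>U. \<exists>\<phi>\<in>\<Delta>. \<exists>b\<in>tuples n. ?T (U \<inter> {a. holds M \<phi> (a @ b)}) \<and>
      ?T (U \<inter> {a. \<not> holds M \<phi> (a @ b)}))"
    using assms
    by (intro definable_op_finite_bex definable_op_split Suc definable2_not definable2_holds) auto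
  then show ?case
  proof (rule definable_op_cong)
    fix U
    have "U \<inter> {a. \<not> holds M \<phi> (a @ b)} = U - solutions (\<phi>, b)" for \<phi> b by auto
    then show "(\<exists>\<phi>\<in>\<Delta>. \<exists>b\<in>tuples n. ?T (U \<inter> {a. holds M \<phi> (a @ b)}) \<and>
        ?T (U \<inter> {a. \<not> holds M \<phi> (a @ b)})) \<longleftrightarrow>
      tree_rank_ge solutions (\<Delta> \<times> tuples n) (Suc k) U" by simp
  qed
qed

text \<open>\<open>G\<close> appears with its arguments swapped because in a definable family the
  varying element comes first and the parameter second.\<close>

lemma definable_op_chain_of_length:
  assumes "definable2 l l G"
  shows "definable_op l (chain_of_length (\<lambda>v w. G w v) N)"
proof (induction N)
  case 0
  then show ?case by (simp add: definable_op_const)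
next
  case (Suc N)
  have "definable2 l l (\<lambda>v w. v = w)"
    unfolding definable2_def by (rule definable_eq
        coord_map_intros | simp)+
  \<comment> \<open>Membership of \<open>v\<close> in \<open>U\<close> is expressed as nonemptiness
    of \<open>U \<inter> {w. w = v}\<close>, to match \<open>definable_op_split\<close>.\<close>
  then have "definable_op l (\<lambda>U. \<exists>v\<in>tuples l. chain_of_length (\<lambda>v w. G w v) N (U \<inter> {w. G w v}) \<and>
      U \<inter> {w. w = v} \<noteq> {})"
    by (intro definable_op_split Suc definable_op_nonempty assms)
  then show ?case by (rule definable_op_cong) auto
qed

definition definable_set :: "nat \<Rightarrow> 'm list set \<Rightarrow> bool" where
  "definable_set l U \<longleftrightarrow> (\<exists>k R. \<exists>c\<in>tuples k. definable2 l k R \<and> U = {a \<in> tuples l. R a c})"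

lemma definable_set_tuples: "definable_set l (tuples l)"
  unfolding definable_set_def
  by (rule exI[of _ 0], rule exI[of _ "\<lambda>_ _. True"]) (auto simp: definable2_def definable_const)

lemma definable_set_Int:
  assumes "definable_set l U" "definable2 l n R'" "b \<in> tuples n"
  shows "definable_set l (U \<inter> {a. R' a b})"
proof -
  obtain k R c where c: "c \<in> tuples k" "definable2 l k R" "U = {a \<in> tuples l. R a c}"
    using assms(1) unfolding definable_set_def by blast
  have "definable2 l (n + k) (\<lambda>a d. R a (drop n d) \<and> R' a (take n d))"
    unfolding definable2_def
    by (rule definable_conj definable2_comp[OF c(2)] definable2_comp[OF assms(2)]
        coord_map_intros | simp)+
  moreover have "U \<inter> {a. R' a b} =
      {a \<in> tuples l. R a (drop n (b @ c)) \<and> R' a (take n (b @ c))}"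
    unfolding c(3) take_append_tuples[OF assms(3)] drop_append_tuples[OF assms(3)] by auto
  ultimately show ?thesis
    unfolding definable_set_def
    by (intro exI[of _ "n + k"] exI[of _ "\<lambda>a d. R a (drop n d) \<and> R' a (take n d)"]
        bexI[OF _ append_tuples[OF assms(3) c(1)]] conjI)
qed

end

section \<open>Saturation, stability and the finite cover property\<close>

text \<open>Finite \<open>A\<close> amounts to saturation at aleph_0. It suffices for infinite
  constructions because earlier choices are absorbed into the single parameter tuple of a definable
  set.\<close>

locale saturated_structure = fo_structure L M
  for L :: "('f, 'r) language" and M :: "('f, 'r, 'm) fo_struct" +
  assumes saturated_finite: "\<And>m A p. finite A \<Longrightarrow> A \<subseteq> univ M \<Longrightarrow>
    p \<subseteq> {(\<phi>, b). set b \<subseteq> A \<and> \<phi> \<in> formulas_in L (m + length b)} \<Longrightarrow>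
    consistent M m p \<Longrightarrow> realized M m p"
begin

lemma realize_countable:
  assumes P: "\<And>N::nat. definable2 l k (P N)" and c: "c \<in> tuples k"
    and ex: "\<And>N. \<exists>a\<in>tuples l. \<forall>j\<le>N. P j a c"
  shows "\<exists>a\<in>tuples l. \<forall>N. P N a c"
proof -
  have "\<forall>N. \<exists>\<phi>. \<phi> \<in> formulas_in L (l + k) \<and>
      (\<forall>a\<in>tuples l. \<forall>b\<in>tuples k. P N a b \<longleftrightarrow> holds M \<phi> (a @ b))"
    using definable2_formula[OF P] by metis
  then obtain \<phi> where \<phi>: "\<And>N. \<phi> N \<in> formulas_in L (l + k)"
    "\<And>N a b. a \<in> tuples l \<Longrightarrow> b \<in> tuples k \<Longrightarrow> P N a b \<longleftrightarrow> holds M (\<phi> N) (a @ b)"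
    by metis
  let ?p = "range (\<lambda>N. (\<phi> N, c))"
  have "realized M l ?p"
  proof (rule saturated_finite)
    show "finite (set c)" by simp
    show "set c \<subseteq> univ M" using c by (simp add: nlists_def)
    show "?p \<subseteq> {(\<phi>, b). set b \<subseteq> set c \<and> \<phi> \<in> formulas_in L (l + length b)}"
      using \<phi>(1) c by (auto simp: nlists_def)
    show "consistent M l ?p"
      unfolding consistent_def
    proof (intro allI impI)
      fix q assume "q \<subseteq> ?p" "finite q"
      then obtain C where C: "finite C" "q = (\<lambda>N. (\<phi> N, c)) ` C"
        by (meson finite_subset_image)
      obtain a where a: "a \<in> tuples l" "\<forall>j\<le>Max C. P j a c" using ex by blast
      then have "realizes M a q"
        using C \<phi>(2)[OF a(1) c] by (auto simp: realizes_def)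
      then show "realized M l q" using a(1) by (auto simp: realized_def)
    qed
  qed
  then obtain a where "a \<in> tuples l" "realizes M a ?p" by (auto simp: realized_def)
  then show ?thesis using \<phi>(2) c by (auto simp: realizes_def)
qed

text \<open>The sequence is built greedily. The remaining set stays definable and keeps chains of
  every finite length; saturation finds a head that preserves this for all lengths
  simultaneously.\<close>

lemma infinite_chain:
  assumes G: "definable2 l l G" and ch: "\<And>N. chain_of_length (\<lambda>v w. G w v) N (tuples l)"
  obtains v :: "nat \<Rightarrow> 'm list" where "range v \<subseteq> tuples l" "\<forall>i j. i < j \<longrightarrow> G (v j) (v i)"
proof -
  let ?ok = "\<lambda>U. definable_set l U \<and> (\<forall>N. chain_of_length (\<lambda>v w. G w v) N U)"
  have step: "\<exists>v\<in>U. ?ok (U \<inter> {w. G w v})" if U: "?ok U" for U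
  proof -
    obtain k R c where c: "c \<in> tuples k" "definable2 l k R" "U = {a \<in> tuples l. R a c}"
      using U unfolding definable_set_def by blast
    \<comment> \<open>\<open>P N\<close> weakens as \<open>N\<close> decreases, so the head of a
      single chain of length \<open>Suc N\<close> satisfies all conditions up to
      \<open>N\<close>.\<close>
    define P where "P = (\<lambda>N v c. R v c \<and>
        chain_of_length (\<lambda>v w. G w v) N {a \<in> tuples l. R a c \<and> G a v})"
    have "definable2 l k (P N)" for N
    proof -
      have "definable2 l (l + k) (\<lambda>a d. R a (drop l d) \<and> G a (take l d))"
        unfolding definable2_def
        by (rule definable_conj definable2_comp[OF c(2)] definable2_comp[OF G]
        coord_map_intros | simp)+
      then have "definable (l + k)
          (\<lambda>d. chain_of_length (\<lambda>v w. G w v) N {a \<in> tuples l. R a (drop l d) \<and> G a (take l d)})"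
        using definable_op_chain_of_length[OF G, of N] unfolding definable_op_def by blast
      then show ?thesis
        using c(2) unfolding P_def definable2_def by (intro definable_conj)
    qed
    moreover have "\<exists>a\<in>tuples l. \<forall>j\<le>N. P j a c" for N
    proof -
      have "chain_of_length (\<lambda>v w. G w v) (Suc N) U" using U by blast
      then obtain v where "v \<in> U" "chain_of_length (\<lambda>v w. G w v) N (U \<inter> {w. G w v})" by auto
      moreover have "U \<inter> {w. G w v} = {a \<in> tuples l. R a c \<and> G a v}" using c by auto
      ultimately show ?thesis
        unfolding P_def using c(3) by (intro bexI[of _ v]) (auto intro: chain_of_length_antimono)
    qed
    ultimately obtain v where v: "v \<in> tuples l" "\<forall>N. P N v c"
      using realize_countable[OF _ c(1)] by blast
    have "U \<inter> {w. G w v} = {a \<in> tuples l. R a c \<and> G a v}" using c by auto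
    then have "\<forall>N. chain_of_length (\<lambda>v w. G w v) N (U \<inter> {w. G w v})"
      using v(2) by (simp add: P_def)
    moreover have "v \<in> U" using v c(3) by (auto simp: P_def)
    moreover have "definable_set l (U \<inter> {w. G w v})"
      using definable_set_Int U G v(1) by blast
    ultimately show ?thesis by blast
  qed
  define nxt where "nxt U = (SOME v. v \<in> U \<and> ?ok (U \<inter> {w. G w v}))" for U
  have nxt: "nxt U \<in> U \<and> ?ok (U \<inter> {w. G w (nxt U)})" if "?ok U" for U
    unfolding nxt_def by (rule someI_ex) (use step[OF that] in blast)
  define U where "U = rec_nat (tuples l) (\<lambda>_ U. U \<inter> {w. G w (nxt U)})"
  have U_Suc: "U (Suc k) = U k \<inter> {w. G w (nxt (U k))}" and U_0: "U 0 = tuples l" for k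
    by (simp_all add: U_def)
  have ok: "?ok (U k)" for k
  proof (induction k)
    case 0
    then show ?case using ch by (simp add: U_0 definable_set_tuples)
  next
    case (Suc k)
    then show ?case unfolding U_Suc using nxt[OF Suc] by blast
  qed
  have mono: "U j \<subseteq> U i" if "i \<le> j" for i j
    using that by (induction rule: dec_induct) (auto simp: U_Suc)
  show ?thesis
  proof (rule that[of "\<lambda>k. nxt (U k)"])
    show "range (\<lambda>k. nxt (U k)) \<subseteq> tuples l"
      using nxt[OF ok] mono[of 0] U_0 by blast
    have "G (nxt (U j)) (nxt (U i))" if "i < j" for i j
    proof -
      have "nxt (U j) \<in> U (Suc i)" using nxt[OF ok[of j]] mono[of "Suc i" j] that by auto
      then show ?thesis by (simp add: U_Suc)
    qed
    then show "\<forall>i j. i < j \<longrightarrow> G (nxt (U j)) (nxt (U i))" by blast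
  qed
qed

text \<open>Trees of unbounded height give ladders of every finite length for one formula. Packing
  each rung into one tuple turns ladders into chains of a definable relation, and an infinite chain
  is an instance of the order property.\<close>

lemma tree_rank_bounded:
  assumes stable: "stable_theory L M"
    and \<Delta>: "finite \<Delta>" "\<Delta> \<subseteq> formulas_in L (m + n)"
  obtains h where "\<not> tree_rank_ge solutions (\<Delta> \<times> tuples n) h (tuples m)"
proof (rule ccontr)
  assume "\<not> thesis"
  then have all: "tree_rank_ge solutions (\<Delta> \<times> tuples n) h (tuples m)" for h using that by blast
  have "\<Delta> \<times> tuples n = (\<Union>\<phi>\<in>\<Delta>. {\<phi>} \<times> tuples n)" by auto
  then obtain \<phi> where \<phi>: "\<phi> \<in> \<Delta>" "\<And>h. tree_rank_ge solutions ({\<phi>} \<times> tuples n) h (tuples m)"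
    using tree_rank_ge_finite_Union[OF \<Delta>(1), of solutions "\<lambda>\<phi>. {\<phi>} \<times> tuples n" "tuples m"] all
    by auto
  have fm: "\<phi> \<in> formulas_in L (m + n)" using \<phi>(1) \<Delta>(2) by blast
  \<comment> \<open>A rung is the tuple \<open>a @ b\<close>, and \<open>G w v\<close> says that
    \<open>v\<close> precedes \<open>w\<close> in the ladder. Only pairs of different rungs are
    compared, so the unspecified diagonal never enters.\<close>
  define G where "G w v \<longleftrightarrow> holds M \<phi> (take m v @ drop m w) \<and> \<not> holds M \<phi> (take m w @ drop m v)"
    for w v
  have Gdef: "definable2 (m + n) (m + n) G"
    unfolding definable2_def G_def
    by (rule definable_conj definable_not definable2_comp[OF definable2_holds[OF fm]]
        coord_map_intros | simp)+
  have ch: "chain_of_length (\<lambda>v w. G w v) N (tuples (m + n))" for N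
  proof -
    obtain h where "\<forall>W Z. tree_rank_ge solutions W h Z \<longrightarrow>
        (\<exists>a c. (\<forall>i<N. a i \<in> Z \<and> c i \<in> W) \<and>
          (\<forall>i<N. \<forall>j<N. i \<noteq> j \<longrightarrow> (a i \<in> solutions (c j) \<longleftrightarrow> i < (j::nat))))"
      using tree_rank_ge_imp_ladder[of solutions N] by (rule exE)
    from this[rule_format, OF \<phi>(2)] obtain a c
      where ac: "\<forall>i<N. a i \<in> tuples m \<and> c i \<in> {\<phi>} \<times> tuples n"
        "\<forall>i<N. \<forall>j<N. i \<noteq> j \<longrightarrow> (a i \<in> solutions (c j) \<longleftrightarrow> i < (j::nat))"
      by (elim exE conjE)
    show ?thesis
    proof (rule chain_of_lengthI[of N "\<lambda>i. a i @ snd (c i)"])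
      fix i assume "i < N"
      then have "a i \<in> tuples m" "snd (c i) \<in> tuples n" using ac(1) by auto
      then show "a i @ snd (c i) \<in> tuples (m + n)" by (rule append_tuples)
    next
      fix i j assume ij: "i < j" "j < N"
      then have "a i \<in> tuples m" "a j \<in> tuples m" "fst (c i) = \<phi>" "fst (c j) = \<phi>"
        using ac(1)[rule_format, of i] ac(1)[rule_format, of j] by auto
      moreover have "a i \<in> solutions (c j)" "a j \<notin> solutions (c i)" using ac(2) ij by auto
      ultimately show "G (a j @ snd (c j)) (a i @ snd (c i))"
        unfolding G_def
        by (simp add: take_append_tuples drop_append_tuples del: take_append drop_append)
    qed
  qed
  obtain v :: "nat \<Rightarrow> 'm list" where v: "range v \<subseteq> tuples (m + n)" "\<forall>i j. i < j \<longrightarrow> G (v j) (v i)"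
    by (rule infinite_chain[OF Gdef ch]) (rule that)
  \<comment> \<open>Taking the points from odd rungs and the parameters from even ones avoids the
    diagonal, and \<open>2 * i + 1 < 2 * j\<close> is equivalent to \<open>i < j\<close>.\<close>
  have "holds M \<phi> (take m (v (2 * i + 1)) @ drop m (v (2 * j))) \<longleftrightarrow> i < j" for i j
  proof (cases "i < j")
    case True
    then show ?thesis using v(2)[rule_format, of "2 * i + 1" "2 * j"] by (auto simp: G_def)
  next
    case False
    then show ?thesis using v(2)[rule_format, of "2 * j" "2 * i + 1"] by (auto simp: G_def)
  qed
  moreover have "take m (v i) \<in> tuples m" "drop m (v i) \<in> tuples n" for i
    using v(1) take_tuples drop_tuples by blast+
  ultimately have "order_property M m n \<phi>"
    unfolding order_property_def
    by (intro exI[of _ "\<lambda>i. take m (v (2 * i + 1))"] exI[of _ "\<lambda>j. drop m (v (2 * j))"]) auto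
  then show False using stable fm unfolding stable_theory_def by blast
qed

end

locale nfcp_structure = fo_structure L M
  for L :: "('f, 'r) language" and M :: "('f, 'r, 'm) fo_struct" +
  assumes nfcp: "\<not> finite_cover_property L M"
begin

text \<open>A finite Helly number for the definable family. A minimal inconsistent set of instances
  is a witness for the finite cover property, so its size is bounded, and every inconsistent finite
  set contains a minimal one.\<close>

lemma nfcp_bound:
  assumes "definable2 l k P"
  obtains K where "\<And>B. B \<subseteq> tuples k \<Longrightarrow> finite B \<Longrightarrow>
    (\<And>B'. B' \<subseteq> B \<Longrightarrow> card B' \<le> K \<Longrightarrow> \<exists>a\<in>tuples l. \<forall>b\<in>B'. P a b) \<Longrightarrow>
    \<exists>a\<in>tuples l. \<forall>b\<in>B. P a b"
proof -
  obtain \<phi> where \<phi>: "\<phi> \<in> formulas_in L (l + k)"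
    "\<And>a b. a \<in> tuples l \<Longrightarrow> b \<in> tuples k \<Longrightarrow> P a b \<longleftrightarrow> holds M \<phi> (a @ b)"
    using definable2_formula[OF assms] by blast
  have cons: "consistent M l ({\<phi>} \<times> B) \<longleftrightarrow> (\<exists>a\<in>tuples l. \<forall>b\<in>B. P a b)"
    if B: "finite B" "B \<subseteq> tuples k" for B
  proof
    assume "consistent M l ({\<phi>} \<times> B)"
    then have "realized M l ({\<phi>} \<times> B)" unfolding consistent_def using B(1) by blast
    then show "\<exists>a\<in>tuples l. \<forall>b\<in>B. P a b"
      using \<phi>(2) B(2) unfolding realized_def realizes_def by blast
  next
    assume "\<exists>a\<in>tuples l. \<forall>b\<in>B. P a b"
    then show "consistent M l ({\<phi>} \<times> B)"
      using \<phi>(2) B(2) unfolding consistent_def realized_def realizes_def by blast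
  qed
  obtain N where N: "\<And>t B. t \<ge> N \<Longrightarrow> B \<subseteq> tuples k \<Longrightarrow> finite B \<Longrightarrow> card B = t \<Longrightarrow>
      \<not> consistent M l ({\<phi>} \<times> B) \<Longrightarrow> \<exists>B'\<subset>B. \<not> consistent M l ({\<phi>} \<times> B')"
    using nfcp \<phi>(1) unfolding finite_cover_property_def by meson
  show ?thesis
  proof (rule that[of N])
    fix B assume B: "B \<subseteq> tuples k" "finite B"
      and small: "\<And>B'. B' \<subseteq> B \<Longrightarrow> card B' \<le> N \<Longrightarrow> \<exists>a\<in>tuples l. \<forall>b\<in>B'. P a b"
    have "consistent M l ({\<phi>} \<times> B')" if "B' \<subseteq> B" for B'
      using finite_subset[OF that B(2)] that
    proof (induction rule: finite_psubset_induct)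
      case (psubset B')
      show ?case
      proof (cases "card B' \<le> N")
        case True
        then show ?thesis using small cons psubset B(1) by (metis subset_trans)
      next
        case False
        show ?thesis
        proof (rule ccontr)
          assume "\<not> consistent M l ({\<phi>} \<times> B')"
          then obtain B'' where "B'' \<subset> B'" "\<not> consistent M l ({\<phi>} \<times> B'')"
            using N[of "card B'" B'] False psubset.prems psubset.hyps B(1)
            by (meson linear subset_trans)
          then show False using psubset by blast
        qed
      qed
    qed
    then show "\<exists>a\<in>tuples l. \<forall>b\<in>B. P a b" using cons B by blast
  qed
qed

end

section \<open>Uniform definability of types and derivatives\<close>

text \<open>Up to \<open>K\<close> tuples of length \<open>n\<close> are coded, repetitions allowed,
  by one tuple of length \<open>K * n\<close>, so that a single quantifier block ranges over all of
  them.\<close>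

definition block :: "nat \<Rightarrow> nat \<Rightarrow> 'a list \<Rightarrow> 'a list" where
  "block n i bs = take n (drop (i * n) bs)"

lemma coord_map_block:
  assumes "coord_map K (j * n) f" "i < j"
  shows "coord_map K n (\<lambda>xs. block n i (f xs))"
proof -
  have "j * n = i * n + (n + (j - Suc i) * n)"
  proof -
    obtain k where "j = Suc (i + k)" using less_imp_Suc_add[OF assms(2)] by blast
    then show ?thesis by (simp add: add_mult_distrib)
  qed
  then have "coord_map K (n + (j - Suc i) * n) (\<lambda>xs. drop (i * n) (f xs))"
    using assms(1) by (intro coord_map_drop) simp
  then show ?thesis unfolding block_def by (rule coord_map_take) simp
qed

text \<open>The pattern \<open>\<tau>\<close> of formulas and signs is separated from the parameters
  \<open>d\<close>. For finite \<Delta> there are finitely many patterns of each length, and for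
  each of them the parameters vary definably.\<close>

primrec literal_list :: "nat \<Rightarrow> ('b \<times> bool) list \<Rightarrow> 'a list \<Rightarrow> (('b \<times> 'a list) \<times> bool) list" where
  "literal_list n [] d = []"
| "literal_list n (x # \<tau>) d = ((fst x, take n d), snd x) # literal_list n \<tau> (drop n d)"

lemma (in fo_structure) literal_list_surj:
  assumes "set ls \<subseteq> (\<Delta> \<times> tuples n) \<times> UNIV"
  shows "\<exists>\<tau>. \<exists>d\<in>tuples (n * length \<tau>). set \<tau> \<subseteq> \<Delta> \<times> UNIV \<and> length \<tau> = length ls \<and>
    literal_list n \<tau> d = ls"
  using assms
proof (induction ls)
  case Nil
  then show ?case by (intro exI[of _ "[]"]) auto
next
  case (Cons x ls)
  then obtain \<tau> d where \<tau>: "d \<in> tuples (n * length \<tau>)" "set \<tau> \<subseteq> \<Delta> \<times> UNIV"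
    "length \<tau> = length ls" "literal_list n \<tau> d = ls" by (metis set_subset_Cons subset_trans)
  obtain \<phi> b s where x: "x = ((\<phi>, b), s)" "\<phi> \<in> \<Delta>" "b \<in> tuples n" using Cons.prems by auto
  show ?case
  proof (intro exI[of _ "(\<phi>, s) # \<tau>"] bexI[of _ "b @ d"] conjI)
    show "b @ d \<in> tuples (n * length ((\<phi>, s) # \<tau>))" using append_tuples[OF x(3) \<tau>(1)] by simp
    show "literal_list n ((\<phi>, s) # \<tau>) (b @ d) = x # ls"
      using \<tau>(4) x
      by (simp add: take_append_tuples drop_append_tuples del: take_append drop_append)
  qed (use \<tau> x in auto)
qed

lemma (in fo_structure) blocks_cover:
  assumes "finite F" "card F \<le> K" "F \<subseteq> tuples n"
  shows "\<exists>bs\<in>tuples (K * n). \<forall>b\<in>F. \<exists>i<K. b = block n i bs"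
  using assms
proof (induction K arbitrary: F)
  case 0
  then show ?case by auto
next
  case (Suc K)
  show ?case
  proof (cases "F = {}")
    case True
    then show ?thesis using tuples_nonempty by auto
  next
    case False
    then obtain b where b: "b \<in> F" by auto
    then obtain bs where bs: "bs \<in> tuples (K * n)" "\<forall>b\<in>F - {b}. \<exists>i<K. b = block n i bs"
    proof -
      have "card (F - {b}) \<le> K" using Suc.prems b by (simp add: card_Diff_singleton)
      then show ?thesis using Suc.IH[of "F - {b}"] Suc.prems that by blast
    qed
    have bn: "b \<in> tuples n" using b Suc.prems by auto
    then have len: "length b = n" by (simp add: nlists_def)
    have "\<exists>i<Suc K. b' = block n i (b @ bs)" if "b' \<in> F" for b'
    proof (cases "b' = b")
      case True
      then show ?thesis by (intro exI[of _ 0]) (simp add: block_def len)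
    next
      case False
      then have "b' \<in> F - {b}" using that by simp
      from bspec[OF bs(2) this] obtain i where "i < K" "b' = block n i bs" by (elim exE conjE)
      then show ?thesis by (intro exI[of _ "Suc i"]) (simp add: block_def len)
    qed
    moreover have "b @ bs \<in> tuples (Suc K * n)" using append_tuples[OF bn bs(1)] by simp
    ultimately show ?thesis by (intro bexI[of _ "b @ bs"] ballI)
  qed
qed

locale local_types = saturated_structure L M + nfcp_structure L M
  for L :: "('f, 'r) language" and M :: "('f, 'r, 'm) fo_struct" +
  fixes \<Delta> :: "('f, 'r) fm set" and m n :: nat
  assumes stable: "stable_theory L M" and finite_\<Delta>: "finite \<Delta>"
    and \<Delta>_formulas: "\<Delta> \<subseteq> formulas_in L (m + n)"
begin

abbreviation instances :: "('f, 'r, 'm) pfm set" where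
  "instances \<equiv> \<Delta> \<times> tuples n"

definition delta_type :: "'m list \<Rightarrow> ('f, 'r, 'm) pfm set" where
  "delta_type a = {i \<in> instances. a \<in> solutions i}"

text \<open>A complete global type is encoded by the set of its positive instances; under this encoding
  \<open>D k\<close> is the \<open>k\<close>-th Cantor--Bendixson derivative of the type space.\<close>

primrec D :: "nat \<Rightarrow> ('f, 'r, 'm) pfm set set" where
  "D 0 = {P. P \<subseteq> instances \<and>
     (\<forall>F. finite F \<and> F \<subseteq> instances \<longrightarrow> (\<exists>a\<in>tuples m. delta_type a \<inter> F = P \<inter> F))}"
| "D (Suc k) = {P \<in> D k.
     \<forall>F. finite F \<and> F \<subseteq> instances \<longrightarrow> (\<exists>P'\<in>D k. P' \<noteq> P \<and> P' \<inter> F = P \<inter> F)}"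

lemma D_0_approx:
  "P \<in> D 0 \<Longrightarrow> finite F \<Longrightarrow> F \<subseteq> instances \<Longrightarrow> \<exists>a\<in>tuples m. delta_type a \<inter> F = P \<inter> F"
  by simp

lemma D_Suc_approx:
  "P \<in> D (Suc k) \<Longrightarrow> finite F \<Longrightarrow> F \<subseteq> instances \<Longrightarrow> \<exists>P'\<in>D k. P' \<noteq> P \<and> P' \<inter> F = P \<inter> F"
  by simp

lemma D_SucI:
  assumes "P \<in> D k"
    and "\<And>F. finite F \<Longrightarrow> F \<subseteq> instances \<Longrightarrow> \<exists>P'\<in>D k. P' \<noteq> P \<and> P' \<inter> F = P \<inter> F"
  shows "P \<in> D (Suc k)"
  using assms by simp

lemma D_Suc_subset: "D (Suc k) \<subseteq> D k"
  by auto

declare D.simps [simp del]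

lemma D_antimono: "k \<le> k' \<Longrightarrow> D k' \<subseteq> D k"
  by (induction rule: dec_induct) (use D_Suc_subset in auto)

lemma D_subset: "D k \<subseteq> Pow instances"
  using D_antimono[of 0 k] by (auto simp: D.simps(1))

lemma delta_type_in_D: "a \<in> tuples m \<Longrightarrow> delta_type a \<in> D 0"
  by (auto simp: delta_type_def D.simps(1))

text \<open>Deleting the isolated points of a closed set leaves a closed set: an \<open>F\<close>
  that isolates \<open>P\<close> in \<open>D k\<close> also keeps the members of
  \<open>D (Suc k)\<close> away from \<open>P\<close>.\<close>

lemma D_closed:
  assumes "P \<subseteq> instances"
    and "\<And>F. finite F \<Longrightarrow> F \<subseteq> instances \<Longrightarrow> \<exists>P'\<in>D k. P' \<inter> F = P \<inter> F"
  shows "P \<in> D k"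
  using assms(2)
proof (induction k)
  case 0
  have "\<exists>a\<in>tuples m. delta_type a \<inter> F = P \<inter> F" if F: "finite F" "F \<subseteq> instances" for F
  proof -
    obtain P' where "P' \<in> D 0" "P' \<inter> F = P \<inter> F" using 0 F by blast
    moreover obtain a where "a \<in> tuples m" "delta_type a \<inter> F = P' \<inter> F"
      using D_0_approx[OF calculation(1) F] by blast
    ultimately show ?thesis by auto
  qed
  then show ?case using assms(1) by (simp add: D.simps(1))
next
  case (Suc k)
  have "\<exists>P'\<in>D k. P' \<inter> F = P \<inter> F" if "finite F" "F \<subseteq> instances" for F
    using Suc.prems[OF that] D_Suc_subset by blast
  then have "P \<in> D k" by (rule Suc.IH)
  show ?case
  proof (rule ccontr)
    assume no: "P \<notin> D (Suc k)"
    then obtain F where F: "finite F" "F \<subseteq> instances"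
      "\<not> (\<exists>P'\<in>D k. P' \<noteq> P \<and> P' \<inter> F = P \<inter> F)"
      using D_SucI[OF \<open>P \<in> D k\<close>] by blast
    obtain P' where P': "P' \<in> D (Suc k)" "P' \<inter> F = P \<inter> F" using Suc.prems[OF F(1,2)] by blast
    then have "P' \<in> D k" "P' \<noteq> P" using no D_Suc_subset by auto
    then show False using F(3) P'(2) by blast
  qed
qed

text \<open>Infinitely many points would accumulate in the cube; as \<open>fits ls\<close> is clopen
  and \<open>D k\<close> closed, the limit would lie in
  \<open>fits ls \<inter> D (Suc k)\<close>.\<close>

lemma finite_fits_D:
  assumes ls: "set ls \<subseteq> instances \<times> UNIV" and empty: "fits ls \<inter> D (Suc k) = {}"
  shows "finite (fits ls \<inter> D k)"
proof (rule ccontr)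
  assume "infinite (fits ls \<inter> D k)"
  then obtain P where P: "\<And>F. finite F \<Longrightarrow> \<exists>P'\<in>fits ls \<inter> D k. P' \<noteq> P \<and> P' \<inter> F = P \<inter> F"
    by (rule infinite_imp_accumulation) blast
  have sub: "P \<subseteq> instances"
  proof
    fix i assume "i \<in> P"
    obtain P' where "P' \<in> D k" "P' \<inter> {i} = P \<inter> {i}" using P[of "{i}"] by auto
    then show "i \<in> instances" using \<open>i \<in> P\<close> D_subset by blast
  qed
  have "P \<in> D k"
  proof (rule D_closed[OF sub])
    fix F :: "('f, 'r, 'm) pfm set" assume "finite F"
    from P[OF this] show "\<exists>P'\<in>D k. P' \<inter> F = P \<inter> F" by (elim bexE) blast
  qed
  have "P \<in> D (Suc k)"
  proof (rule D_SucI[OF \<open>P \<in> D k\<close>])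
    fix F :: "('f, 'r, 'm) pfm set" assume "finite F"
    from P[OF this] show "\<exists>P'\<in>D k. P' \<noteq> P \<and> P' \<inter> F = P \<inter> F" by (elim bexE) blast
  qed
  moreover obtain P' where P': "P' \<in> fits ls" "P' \<inter> fst ` set ls = P \<inter> fst ` set ls"
    using P[of "fst ` set ls"] by auto
  have "P \<in> fits ls" by (rule fits_cong[OF P'(1)]) (use P'(2) in simp)
  ultimately show False using empty by blast
qed

abbreviation tree :: "nat \<Rightarrow> 'm list set \<Rightarrow> bool" where
  "tree \<equiv> tree_rank_ge solutions instances"

abbreviation realizations :: "(('f, 'r, 'm) pfm \<times> bool) list \<Rightarrow> 'm list set" where
  "realizations ls \<equiv> {a \<in> tuples m. delta_type a \<in> fits ls}"

lemma realizations_Cons: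
  assumes "i \<in> instances"
  shows "realizations ((i, True) # ls) = realizations ls \<inter> solutions i"
    and "realizations ((i, False) # ls) = realizations ls - solutions i"
  using assms by (auto simp: delta_type_def)

lemma D_0_realizations:
  assumes "P \<in> D 0" "P \<in> fits ls" "set ls \<subseteq> instances \<times> UNIV"
  shows "realizations ls \<noteq> {}"
proof -
  have "finite (fst ` set ls)" "fst ` set ls \<subseteq> instances" using assms(3) by force+
  from D_0_approx[OF assms(1) this]
  obtain a where a: "a \<in> tuples m" "delta_type a \<inter> fst ` set ls = P \<inter> fst ` set ls"
    by (elim bexE)
  have "delta_type a \<in> fits ls" by (rule fits_cong[OF assms(2) a(2)])
  then show ?thesis using a(1) by blast
qed

text \<open>A limit point and a nearby point of \<open>D k\<close> satisfy the same literals of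
  \<open>ls\<close> but differ at some instance \<open>i\<close>. Splitting at \<open>i\<close>
  leaves a point of \<open>D k\<close> on either side.\<close>

lemma D_imp_tree:
  "P \<in> D k \<Longrightarrow> P \<in> fits ls \<Longrightarrow> set ls \<subseteq> instances \<times> UNIV \<Longrightarrow> tree k (realizations ls)"
proof (induction k arbitrary: P ls)
  case 0
  then show ?case using D_0_realizations by simp
next
  case (Suc k)
  have "finite (fst ` set ls)" "fst ` set ls \<subseteq> instances" using Suc.prems(3) by force+
  from D_Suc_approx[OF Suc.prems(1) this]
  obtain P' where P': "P' \<in> D k" "P' \<noteq> P" "P' \<inter> fst ` set ls = P \<inter> fst ` set ls"
    by (elim bexE conjE)
  have P'fits: "P' \<in> fits ls" by (rule fits_cong[OF Suc.prems(2) P'(3)])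
  have PD: "P \<in> D k" using Suc.prems(1) D_Suc_subset by blast
  obtain i where i: "i \<in> P' \<longleftrightarrow> i \<notin> P" using P'(2) by blast
  then have iI: "i \<in> instances" using PD P'(1) D_subset by blast
  have "tree k (realizations ((i, s) # ls))" for s
  proof -
    have *: "set ((i, s) # ls) \<subseteq> instances \<times> UNIV" using iI Suc.prems(3) by auto
    show ?thesis
    proof (cases "i \<in> P \<longleftrightarrow> s")
      case True
      then show ?thesis using Suc.IH[OF PD _ *] Suc.prems(2) by simp
    next
      case False
      then show ?thesis using Suc.IH[OF P'(1) _ *] P'fits i by simp
    qed
  qed
  from this[of True] this[of False] show ?case
    using iI unfolding realizations_Cons[OF iI] tree_rank_ge.simps by blast
qed

text \<open>Each literal that lowers the tree rank is added; as the rank is bounded, boundedly many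
  literals suffice, and afterwards the type consists of the formulas that keep the rank.\<close>

lemma type_by_rank:
  assumes h: "\<not> tree h (tuples m)" and P: "P \<in> D 0"
  shows "\<exists>ls r. set ls \<subseteq> instances \<times> UNIV \<and> length ls \<le> h \<and> r \<le> h \<and>
    P = {i \<in> instances. tree r (realizations ls \<inter> solutions i)}"
proof -
  \<comment> \<open>Adding a literal is paid for by lowering \<open>r\<close>, so the sum
    \<open>length ls + r\<close> never exceeds \<open>h\<close>. This bounds the number of literals
    and the rank together.\<close>
  let ?ok = "\<lambda>r ls. set ls \<subseteq> instances \<times> UNIV \<and> P \<in> fits ls \<and> length ls + r \<le> h \<and>
    \<not> tree (Suc r) (realizations ls)"
  have "h \<noteq> 0"
  proof
    assume "h = 0"
    then show False using h tuples_nonempty by simp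
  qed
  then have "?ok (h - 1) []" using h by simp
  then have ex: "\<exists>r ls. ?ok r ls" by blast
  \<comment> \<open>By minimality of \<open>r\<close>, adding any further literal of
    \<open>P\<close> leaves a set that still has rank at least \<open>r\<close>.\<close>
  define r where "r = (LEAST r. \<exists>ls. ?ok r ls)"
  have "\<exists>ls. ?ok r ls" unfolding r_def by (rule LeastI_ex) (use ex in blast)
  then obtain ls where ls: "set ls \<subseteq> instances \<times> UNIV" "P \<in> fits ls" "length ls + r \<le> h"
    "\<not> tree (Suc r) (realizations ls)" by blast
  have least: "r \<le> r'" if "?ok r' ls'" for r' ls'
    unfolding r_def by (rule Least_le) (use that in blast)
  have keep: "tree r (realizations ((i, i \<in> P) # ls))" if i: "i \<in> instances" for i
  proof -
    have lits: "set ((i, i \<in> P) # ls) \<subseteq> instances \<times> UNIV" "P \<in> fits ((i, i \<in> P) # ls)"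
      using i ls by auto
    show ?thesis
    proof (cases r)
      case 0
      then show ?thesis using D_0_realizations[OF P lits(2,1)] by simp
    next
      case (Suc r')
      show ?thesis
      proof (rule ccontr)
        assume "\<not> ?thesis"
        then have "?ok r' ((i, i \<in> P) # ls)" using lits ls(3) Suc by auto
        then have "r \<le> r'" by (rule least)
        then show False using Suc by simp
      qed
    qed
  qed
  have "i \<in> P \<longleftrightarrow> tree r (realizations ls \<inter> solutions i)" if i: "i \<in> instances" for i
  proof (cases "i \<in> P")
    case True
    then show ?thesis using keep[OF i] realizations_Cons(1)[OF i] by simp
  next
    case False
    then have "tree r (realizations ls - solutions i)"
      using keep[OF i] realizations_Cons(2)[OF i] by simp
    \<comment> \<open>If both halves had rank at least \<open>r\<close>, the instance
      \<open>i\<close> would be the root of a tree of height \<open>Suc r\<close>.\<close>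
    then have "\<not> tree r (realizations ls \<inter> solutions i)" using ls(4) i by auto
    then show ?thesis using False by simp
  qed
  moreover have "P \<subseteq> instances" using P D_subset by blast
  ultimately have "P = {i \<in> instances. tree r (realizations ls \<inter> solutions i)}" by blast
  then show ?thesis using ls(1,3) by (intro exI[of _ ls] exI[of _ r]) simp
qed

section \<open>Definable families of types and of their derivatives\<close>

text \<open>A member need not be a type: some tuples code sets that are not finitely satisfiable.
  The good codes are singled out by \<open>definable_D\<close>.\<close>

definition family :: "nat \<Rightarrow> ('m list \<Rightarrow> ('f, 'r, 'm) pfm set) \<Rightarrow> bool" where
  "family l Q \<longleftrightarrow> (\<forall>c. Q c \<subseteq> instances) \<and> (\<forall>\<phi>\<in>\<Delta>. definable2 l n (\<lambda>c b. (\<phi>, b) \<in> Q c))"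

lemma family_definable2: "family l Q \<Longrightarrow> \<phi> \<in> \<Delta> \<Longrightarrow> definable2 l n (\<lambda>c b. (\<phi>, b) \<in> Q c)"
  by (simp add: family_def)

lemma family_comp:
  "family l Q \<Longrightarrow> \<phi> \<in> \<Delta> \<Longrightarrow> coord_map K l f \<Longrightarrow> coord_map K n g \<Longrightarrow>
    definable K (\<lambda>xs. (\<phi>, g xs) \<in> Q (f xs))"
  using definable2_comp[OF family_definable2] .

lemma family_delta_type: "family m delta_type"
  unfolding family_def
proof (intro conjI ballI allI)
  fix \<phi> assume \<phi>: "\<phi> \<in> \<Delta>"
  then have "definable2 m n (\<lambda>a b. holds M \<phi> (a @ b))"
    using \<Delta>_formulas by (intro definable2_holds) auto
  then show "definable2 m n (\<lambda>a b. (\<phi>, b) \<in> delta_type a)"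
    by (rule definable2_cong) (use \<phi> in \<open>simp add: delta_type_def\<close>)
qed (auto simp: delta_type_def)

lemma family_fits:
  assumes Q: "family l Q" and "set \<tau> \<subseteq> \<Delta> \<times> UNIV"
  shows "definable2 l (n * length \<tau>) (\<lambda>c d. Q c \<in> fits (literal_list n \<tau> d))"
  using assms(2)
proof (induction \<tau>)
  case Nil
  then show ?case by (simp add: definable2_def definable_const)
next
  case (Cons x \<tau>)
  then have IH: "definable2 l (n * length \<tau>) (\<lambda>c d. Q c \<in> fits (literal_list n \<tau> d))"
    and x: "fst x \<in> \<Delta>" by auto
  have "definable2 l (n + n * length \<tau>) (\<lambda>c d. ((fst x, take n d) \<in> Q c \<longleftrightarrow> snd x) \<and>
      Q c \<in> fits (literal_list n \<tau> (drop n d)))"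
    unfolding definable2_def
    by (rule definable_conj definable_iff definable_const definable2_comp[OF IH]
        family_comp[OF Q x]
        coord_map_intros | simp)+
  then show ?case by simp
qed

definition rank_type ::
    "(('f, 'r) fm \<times> bool) list \<Rightarrow> nat \<Rightarrow> 'm list \<Rightarrow> ('f, 'r, 'm) pfm set" where
  "rank_type \<tau> r d = {i \<in> instances. tree r (realizations (literal_list n \<tau> d) \<inter> solutions i)}"

lemma family_rank_type:
  assumes "set \<tau> \<subseteq> \<Delta> \<times> UNIV"
  shows "family (n * length \<tau>) (rank_type \<tau> r)"
  unfolding family_def
proof (intro conjI ballI allI)
  fix \<phi> assume \<phi>: "\<phi> \<in> \<Delta>"
  then have fm: "\<phi> \<in> formulas_in L (m + n)" using \<Delta>_formulas by blast
  let ?N = "n * length \<tau>"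
  have "definable2 m (?N + n) (\<lambda>a e. delta_type a \<in> fits (literal_list n \<tau> (take ?N e)) \<and>
      holds M \<phi> (a @ drop ?N e))"
    unfolding definable2_def
    by (rule definable_conj definable2_comp[OF family_fits[OF family_delta_type assms]]
        definable2_comp[OF definable2_holds[OF fm]]
        coord_map_intros | simp)+
  then have "definable (?N + n) (\<lambda>e. tree r
      {a \<in> tuples m. delta_type a \<in> fits (literal_list n \<tau> (take ?N e)) \<and>
        holds M \<phi> (a @ drop ?N e)})"
    using definable_op_tree_rank_ge[OF finite_\<Delta> \<Delta>_formulas] unfolding definable_op_def by blast
  then show "definable2 ?N n (\<lambda>d b. (\<phi>, b) \<in> rank_type \<tau> r d)"
    unfolding definable2_def
  proof (rule definable_cong)
    fix xs assume "xs \<in> tuples (?N + n)"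
    then have "drop ?N xs \<in> tuples n" by (rule drop_tuples)
    moreover have "{a \<in> tuples m. delta_type a \<in> fits (literal_list n \<tau> (take ?N xs)) \<and>
        holds M \<phi> (a @ drop ?N xs)} =
        realizations (literal_list n \<tau> (take ?N xs)) \<inter> solutions (\<phi>, drop ?N xs)" by auto
    ultimately show "tree r {a \<in> tuples m. delta_type a \<in> fits (literal_list n \<tau> (take ?N xs)) \<and>
        holds M \<phi> (a @ drop ?N xs)} \<longleftrightarrow> (\<phi>, drop ?N xs) \<in> rank_type \<tau> r (take ?N xs)"
      using \<phi> by (simp add: rank_type_def)
  qed
qed (auto simp: rank_type_def)

text \<open>Uniform definability of types. Patterns of length at most \<open>h\<close> and ranks at
  most \<open>h\<close> are finite in number, and only the parameters remain free.\<close>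

lemma families_cover:
  obtains \<Gamma> where "finite \<Gamma>" "\<forall>x\<in>\<Gamma>. family (fst x) (snd x)"
    "\<forall>P\<in>D 0. \<exists>x\<in>\<Gamma>. \<exists>c\<in>tuples (fst x). P = snd x c"
proof -
  obtain h where h: "\<not> tree h (tuples m)"
    using tree_rank_bounded[OF stable finite_\<Delta> \<Delta>_formulas] by blast
  let ?A = "{\<tau>. set \<tau> \<subseteq> \<Delta> \<times> (UNIV :: bool set) \<and> length \<tau> \<le> h}"
  let ?\<Gamma> = "(\<lambda>(\<tau>, r). (n * length \<tau>, rank_type \<tau> r)) ` (?A \<times> {..h})"
  have "finite ?A" by (rule finite_lists_length_le) (use finite_\<Delta> in simp)
  then have "finite ?\<Gamma>" by simp
  moreover have "\<forall>x\<in>?\<Gamma>. family (fst x) (snd x)" using family_rank_type by auto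
  moreover have "\<exists>x\<in>?\<Gamma>. \<exists>c\<in>tuples (fst x). P = snd x c" if P: "P \<in> D 0" for P
  proof -
    obtain ls r where ls: "set ls \<subseteq> instances \<times> UNIV" "length ls \<le> h" "r \<le> h"
      "P = {i \<in> instances. tree r (realizations ls \<inter> solutions i)}"
      using type_by_rank[OF h P] by blast
    obtain \<tau> d where \<tau>: "d \<in> tuples (n * length \<tau>)" "set \<tau> \<subseteq> \<Delta> \<times> UNIV" "length \<tau> = length ls"
      "literal_list n \<tau> d = ls" using literal_list_surj[OF ls(1)] by blast
    have "P = rank_type \<tau> r d" using ls(4) \<tau>(4) by (simp add: rank_type_def)
    moreover have "(n * length \<tau>, rank_type \<tau> r) \<in> ?\<Gamma>"
      using \<tau> ls by (intro image_eqI[of _ _ "(\<tau>, r)"]) auto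
    ultimately show ?thesis using \<tau>(1) by (intro bexI[of _ "(n * length \<tau>, rank_type \<tau> r)"]) auto
  qed
  ultimately show ?thesis by (intro that[of ?\<Gamma>]) blast+
qed

text \<open>For fixed \<open>c\<close>, the requirements that \<open>Q' c'\<close> agree with
  \<open>Q c\<close> over \<open>b\<close> are instances, with parameters \<open>b\<close> and
  \<open>c\<close>, of one formula in \<open>c'\<close>. By \<open>nfcp_bound\<close> it is enough
  to satisfy any \<open>K\<close> of them jointly, and that can be expressed by quantifying over
  \<open>K\<close> blocks.\<close>

lemma definable_approximable:
  assumes Q: "family l Q" and Q': "family l' Q'" and Z: "definable2 l' l Z"
  shows "definable l (\<lambda>c. \<forall>F. finite F \<and> F \<subseteq> instances \<longrightarrow>
    (\<exists>c'\<in>tuples l'. Z c' c \<and> Q' c' \<inter> F = Q c \<inter> F))"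
proof -
  define agree where "agree c' c b \<longleftrightarrow> (\<forall>\<phi>\<in>\<Delta>. (\<phi>, b) \<in> Q' c' \<longleftrightarrow> (\<phi>, b) \<in> Q c)" for c' c b
  have agree: "definable K (\<lambda>xs. agree (f xs) (g xs) (k xs))"
    if "coord_map K l' f" "coord_map K l g" "coord_map K n k" for K f g k
    unfolding agree_def using that finite_\<Delta>
    by (intro definable_finite_ball definable_iff family_comp[OF Q] family_comp[OF Q'])
  \<comment> \<open>\<open>Z\<close> is built into each requirement, so that every solution of a
    nonempty set of requirements satisfies it.\<close>
  define R where "R c' d \<longleftrightarrow> Z c' (drop n d) \<and> agree c' (drop n d) (take n d)" for c' d
  have "definable2 l' (n + l) R"
    unfolding definable2_def R_def
    by (rule definable_conj definable2_comp[OF Z] agree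
        coord_map_intros | simp)+
  then obtain K where K: "\<And>B. B \<subseteq> tuples (n + l) \<Longrightarrow> finite B \<Longrightarrow>
      (\<And>B'. B' \<subseteq> B \<Longrightarrow> card B' \<le> K \<Longrightarrow> \<exists>a\<in>tuples l'. \<forall>b\<in>B'. R a b) \<Longrightarrow>
      \<exists>a\<in>tuples l'. \<forall>b\<in>B. R a b" by (rule nfcp_bound) blast
  have "definable l (\<lambda>c. \<forall>bs\<in>tuples (K * n). \<exists>c'\<in>tuples l'. Z c' c \<and>
      (\<forall>i\<in>{..<K}. agree c' c (block n i bs)))"
    by (rule definable_all definable_ex definable_conj definable_finite_ball
        definable2_comp[OF Z] agree coord_map_block
        coord_map_intros | simp)+
  then show ?thesis
  proof (rule definable_cong)
    fix c assume c: "c \<in> tuples l"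
    show "(\<forall>bs\<in>tuples (K * n). \<exists>c'\<in>tuples l'. Z c' c \<and> (\<forall>i\<in>{..<K}. agree c' c (block n i bs))) \<longleftrightarrow>
      (\<forall>F. finite F \<and> F \<subseteq> instances \<longrightarrow> (\<exists>c'\<in>tuples l'. Z c' c \<and> Q' c' \<inter> F = Q c \<inter> F))"
      (is "?lhs \<longleftrightarrow> ?rhs")
    proof
      assume lhs: ?lhs
      show ?rhs
      proof (intro allI impI, elim conjE)
        fix F assume F: "finite F" "F \<subseteq> instances"
        \<comment> \<open>The extra tuple \<open>b0\<close> keeps the set of requirements nonempty
          for \<open>F = {}\<close>; otherwise \<open>Z c' c\<close> could not be recovered.\<close>
        obtain b0 where b0: "b0 \<in> tuples n" using tuples_nonempty by blast
        let ?Fb = "insert b0 (snd ` F)"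
        have Fb: "?Fb \<subseteq> tuples n" "finite ?Fb" using F b0 by auto
        let ?B = "(\<lambda>b. b @ c) ` ?Fb"
        have R_app: "R c' (b @ c) \<longleftrightarrow> Z c' c \<and> agree c' c b" if "b \<in> tuples n" for b c'
          using that unfolding R_def
          by (simp add: take_append_tuples drop_append_tuples del: take_append drop_append)
        have "\<exists>a\<in>tuples l'. \<forall>b\<in>?B. R a b"
        proof (rule K)
          show "?B \<subseteq> tuples (n + l)" using Fb append_tuples c by blast
          show "finite ?B" using Fb by simp
          fix B' assume B': "B' \<subseteq> ?B" "card B' \<le> K"
          then obtain F' where F': "F' \<subseteq> ?Fb" "B' = (\<lambda>b. b @ c) ` F'" by (meson subset_imageE)
          have "inj_on (\<lambda>b. b @ c) F'" by (auto simp: inj_on_def)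
          then have "card F' \<le> K" using B'(2) F'(2) by (simp add: card_image)
          then obtain bs where bs: "bs \<in> tuples (K * n)" "\<forall>b\<in>F'. \<exists>i<K. b = block n i bs"
            using blocks_cover[of F' K n] F'(1) Fb finite_subset by (metis subset_trans)
          obtain c' where c': "c' \<in> tuples l'" "Z c' c" "\<forall>i\<in>{..<K}. agree c' c (block n i bs)"
            using lhs bs(1) by blast
          have "R c' (b @ c)" if "b \<in> F'" for b
          proof -
            have "b \<in> tuples n" using that F'(1) Fb(1) by blast
            moreover have "agree c' c b" using bs(2) c'(3) that by auto
            ultimately show ?thesis using R_app c'(2) by blast
          qed
          then show "\<exists>a\<in>tuples l'. \<forall>b\<in>B'. R a b" using c'(1) F'(2) by blast
        qed
        then obtain c' where c': "c' \<in> tuples l'" "\<forall>b\<in>?Fb. R c' (b @ c)" by blast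
        then have "Z c' c" using R_app[OF b0] by simp
        moreover have "Q' c' \<inter> F = Q c \<inter> F"
        proof -
          have "(\<phi>, b) \<in> Q' c' \<longleftrightarrow> (\<phi>, b) \<in> Q c" if "(\<phi>, b) \<in> F" for \<phi> b
          proof -
            have "b \<in> ?Fb" "\<phi> \<in> \<Delta>" using that F(2) by force+
            then show ?thesis using c'(2) R_app Fb(1) unfolding agree_def by blast
          qed
          then show ?thesis by auto
        qed
        ultimately show "\<exists>c'\<in>tuples l'. Z c' c \<and> Q' c' \<inter> F = Q c \<inter> F" using c'(1) by blast
      qed
    next
      assume rhs: ?rhs
      show ?lhs
      proof
        fix bs assume bs: "bs \<in> tuples (K * n)"
        let ?F = "\<Delta> \<times> (\<lambda>i. block n i bs) ` {..<K}"
        have bn: "block n i bs \<in> tuples n" if "i < K" for i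
          using coord_map_nlists[OF coord_map_block[OF coord_map_id that] bs] .
        then have "finite ?F \<and> ?F \<subseteq> instances" using finite_\<Delta> by auto
        then obtain c' where c': "c' \<in> tuples l'" "Z c' c" "Q' c' \<inter> ?F = Q c \<inter> ?F"
          using rhs by meson
        have "agree c' c (block n i bs)" if "i < K" for i
          unfolding agree_def
        proof
          fix \<phi> assume "\<phi> \<in> \<Delta>"
          then have "(\<phi>, block n i bs) \<in> ?F" using that by auto
          then show "(\<phi>, block n i bs) \<in> Q' c' \<longleftrightarrow> (\<phi>, block n i bs) \<in> Q c" using c'(3) by blast
        qed
        then show "\<exists>c'\<in>tuples l'. Z c' c \<and> (\<forall>i\<in>{..<K}. agree c' c (block n i bs))"
          using c' by blast
      qed
    qed
  qed
qed

lemma definable2_family_neq: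
  assumes Q: "family l Q" and Q': "family l' Q'"
  shows "definable2 l' l (\<lambda>c' c. Q' c' \<noteq> Q c)"
proof -
  have "definable2 l' l (\<lambda>c' c. \<exists>b\<in>tuples n. \<exists>\<phi>\<in>\<Delta>. \<not> ((\<phi>, b) \<in> Q' c' \<longleftrightarrow> (\<phi>, b) \<in> Q c))"
    unfolding definable2_def
    by (rule definable_ex definable_finite_bex[OF finite_\<Delta>] definable_not definable_iff
        family_comp[OF Q] family_comp[OF Q'] coord_map_intros | simp | assumption)+
  moreover have "(\<exists>b\<in>tuples n. \<exists>\<phi>\<in>\<Delta>. \<not> ((\<phi>, b) \<in> Q' c' \<longleftrightarrow> (\<phi>, b) \<in> Q c)) \<longleftrightarrow> Q' c' \<noteq> Q c" for c' c
  proof -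
    have "Q' c' \<subseteq> instances" "Q c \<subseteq> instances" using Q Q' by (auto simp: family_def)
    then show ?thesis by (auto; blast)
  qed
  ultimately show ?thesis by simp
qed

text \<open>Being a limit point quantifies over types, which are replaced by their codes in finitely
  many families. For \<open>definable_approximable\<close> to apply, one family has to serve all
  \<open>F\<close>; finiteness of \<open>\<Gamma>\<close> allows this exchange of
  quantifiers.\<close>

lemma definable_D: "family l Q \<Longrightarrow> definable l (\<lambda>c. Q c \<in> D k)"
proof (induction k arbitrary: l Q)
  case 0
  have "definable l (\<lambda>c. \<forall>F. finite F \<and> F \<subseteq> instances \<longrightarrow>
      (\<exists>a\<in>tuples m. True \<and> delta_type a \<inter> F = Q c \<inter> F))"
    by (rule definable_approximable[OF 0 family_delta_type])
      (simp add: definable2_def definable_const)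
  moreover have "Q c \<subseteq> instances" for c using 0 by (simp add: family_def)
  ultimately show ?case by (simp add: D.simps(1))
next
  case (Suc k)
  obtain \<Gamma> where \<Gamma>: "finite \<Gamma>" "\<forall>x\<in>\<Gamma>. family (fst x) (snd x)"
    "\<forall>P\<in>D 0. \<exists>x\<in>\<Gamma>. \<exists>c\<in>tuples (fst x). P = snd x c"
    by (rule families_cover)
  let ?A = "\<lambda>x c. \<forall>F. finite F \<and> F \<subseteq> instances \<longrightarrow> (\<exists>c'\<in>tuples (fst x).
      (snd x c' \<in> D k \<and> snd x c' \<noteq> Q c) \<and> snd x c' \<inter> F = Q c \<inter> F)"
  have "definable l (?A x)" if x: "x \<in> \<Gamma>" for x
  proof -
    have fam: "family (fst x) (snd x)" using \<Gamma>(2) x by simp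
    have "definable2 (fst x) l (\<lambda>c' c. snd x c' \<in> D k)"
      unfolding definable2_def
      by (rule definable_comp[OF Suc.IH[OF fam]]
        coord_map_intros | simp)+
    then have "definable2 (fst x) l (\<lambda>c' c. snd x c' \<in> D k \<and> snd x c' \<noteq> Q c)"
      using definable2_family_neq[OF Suc.prems fam] unfolding definable2_def
      by (rule definable_conj)
    then show ?thesis by (rule definable_approximable[OF Suc.prems fam])
  qed
  then have "definable l (\<lambda>c. Q c \<in> D k \<and> (\<exists>x\<in>\<Gamma>. ?A x c))"
    using Suc \<Gamma>(1) by (intro definable_conj definable_finite_bex)
  then show ?case
  proof (rule definable_cong)
    fix c assume c: "c \<in> tuples l"
    show "Q c \<in> D k \<and> (\<exists>x\<in>\<Gamma>. ?A x c) \<longleftrightarrow> Q c \<in> D (Suc k)"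
    proof
      assume "Q c \<in> D k \<and> (\<exists>x\<in>\<Gamma>. ?A x c)"
      then obtain x where x: "Q c \<in> D k" "?A x c" by blast
      show "Q c \<in> D (Suc k)"
      proof (rule D_SucI[OF x(1)])
        fix F assume "finite F" "F \<subseteq> instances"
        from x(2)[rule_format, OF conjI[OF this]] obtain c' where
          "snd x c' \<in> D k" "snd x c' \<noteq> Q c" "snd x c' \<inter> F = Q c \<inter> F" by (elim bexE conjE)
        then show "\<exists>P'\<in>D k. P' \<noteq> Q c \<and> P' \<inter> F = Q c \<inter> F"
          by (intro bexI[of _ "snd x c'"] conjI)
      qed
    next
      assume lim: "Q c \<in> D (Suc k)"
      have "\<exists>x\<in>\<Gamma>. ?A x c"
      proof (rule ccontr)
        assume no: "\<not> ?thesis"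
        \<comment> \<open>If each family failed at some \<open>F x\<close>, the union of these
          finitely many sets would be a finite set on which no other type of \<open>D k\<close>
          agrees with \<open>Q c\<close>.\<close>
        define near where "near x F \<longleftrightarrow> (\<exists>c'\<in>tuples (fst x).
          (snd x c' \<in> D k \<and> snd x c' \<noteq> Q c) \<and> snd x c' \<inter> F = Q c \<inter> F)" for x F
        have "\<forall>x\<in>\<Gamma>. \<exists>F. finite F \<and> F \<subseteq> instances \<and> \<not> near x F"
          using no unfolding near_def[symmetric] by blast
        then obtain F where F: "\<forall>x\<in>\<Gamma>. finite (F x) \<and> F x \<subseteq> instances \<and> \<not> near x (F x)"
          by (rule bchoice[THEN exE])
        have "finite (\<Union>x\<in>\<Gamma>. F x)" "(\<Union>x\<in>\<Gamma>. F x) \<subseteq> instances" using F \<Gamma>(1) by blast+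
        from D_Suc_approx[OF lim this] obtain P
          where P: "P \<in> D k" "P \<noteq> Q c" "P \<inter> (\<Union>x\<in>\<Gamma>. F x) = Q c \<inter> (\<Union>x\<in>\<Gamma>. F x)"
          by (elim bexE conjE)
        have "P \<in> D 0" using P(1) D_antimono[of 0 k] by auto
        then obtain x c' where x: "x \<in> \<Gamma>" "c' \<in> tuples (fst x)" "P = snd x c'"
          using \<Gamma>(3) by blast
        then have "P \<inter> F x = Q c \<inter> F x" using P(3) by blast
        then have "near x (F x)" unfolding near_def using x P by (intro bexI[of _ c']) simp_all
        then show False using F x(1) by blast
      qed
      then show "Q c \<in> D k \<and> (\<exists>x\<in>\<Gamma>. ?A x c)" using lim D_Suc_subset by blast
    qed
  qed
qed

text \<open>Consider the requirements of belonging to the set and differing from a given member. If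
  there are more than \<open>K\<close> members, any \<open>K\<close> of these requirements are met
  by a member left over; by \<open>nfcp_bound\<close> all are met together, which is absurd for a
  finite set.\<close>

lemma family_card_bound:
  assumes Q: "family l Q" and Z: "definable2 l k Z"
  shows "\<exists>N. \<forall>d\<in>tuples k. finite (Q ` {c \<in> tuples l. Z c d}) \<longrightarrow>
    card (Q ` {c \<in> tuples l. Z c d}) \<le> N"
proof -
  define R where "R c' e \<longleftrightarrow> Z c' (drop l e) \<and> Q c' \<noteq> Q (take l e)" for c' e
  have "definable2 l (l + k) R"
    unfolding definable2_def R_def
    by (rule definable_conj definable2_comp[OF Z] definable2_comp[OF definable2_family_neq[OF Q Q]]
       
        coord_map_intros | simp)+
  then obtain K where K: "\<And>B. B \<subseteq> tuples (l + k) \<Longrightarrow> finite B \<Longrightarrow>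
      (\<And>B'. B' \<subseteq> B \<Longrightarrow> card B' \<le> K \<Longrightarrow> \<exists>a\<in>tuples l. \<forall>b\<in>B'. R a b) \<Longrightarrow>
      \<exists>a\<in>tuples l. \<forall>b\<in>B. R a b" by (rule nfcp_bound) blast
  have "card (Q ` {c \<in> tuples l. Z c d}) \<le> K"
    if d: "d \<in> tuples k" and fin: "finite (Q ` {c \<in> tuples l. Z c d})" for d
  proof (rule ccontr)
    let ?Q = "Q ` {c \<in> tuples l. Z c d}"
    assume "\<not> card ?Q \<le> K"
    have "\<forall>P\<in>?Q. \<exists>c. c \<in> tuples l \<and> Z c d \<and> Q c = P" by auto
    then obtain g where g: "\<forall>P\<in>?Q. g P \<in> tuples l \<and> Z (g P) d \<and> Q (g P) = P"
      by (rule bchoice[THEN exE])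
    have R_app: "R c' (c @ d) \<longleftrightarrow> Z c' d \<and> Q c' \<noteq> Q c" if "c \<in> tuples l" for c c'
      using that unfolding R_def
      by (simp add: take_append_tuples drop_append_tuples del: take_append drop_append)
    let ?f = "\<lambda>P. g P @ d"
    have inj: "inj_on ?f ?Q"
    proof (rule inj_onI)
      fix P P' assume P: "P \<in> ?Q" "P' \<in> ?Q" and "?f P = ?f P'"
      then have "g P = g P'" by simp
      then show "P = P'" using g P by metis
    qed
    have "\<exists>a\<in>tuples l. \<forall>b\<in>?f ` ?Q. R a b"
    proof (rule K)
      show "?f ` ?Q \<subseteq> tuples (l + k)" using g append_tuples[OF _ d] by blast
      show "finite (?f ` ?Q)" using fin by simp
      fix B' assume B': "B' \<subseteq> ?f ` ?Q" "card B' \<le> K"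
      have "card (?f ` ?Q) > K" using \<open>\<not> card ?Q \<le> K\<close> card_image[OF inj] by simp
      then have "B' \<noteq> ?f ` ?Q" using B'(2) by auto
      then obtain P where P: "P \<in> ?Q" "?f P \<notin> B'" using B'(1) by blast
      have "R (g P) b" if "b \<in> B'" for b
      proof -
        from subsetD[OF B'(1) that] obtain P' where P': "P' \<in> ?Q" "b = ?f P'" by (rule imageE)
        then have "P' \<noteq> P" using P(2) that by auto
        then show ?thesis using P P' g R_app by auto
      qed
      moreover have "g P \<in> tuples l" using bspec[OF g P(1)] by blast
      ultimately show "\<exists>a\<in>tuples l. \<forall>b\<in>B'. R a b" by (intro bexI[of _ "g P"] ballI)
    qed
    then obtain c' where c': "c' \<in> tuples l" "\<forall>b\<in>?f ` ?Q. R c' b" by (elim bexE)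
    then have c'R: "R c' (g P @ d)" if "P \<in> ?Q" for P using imageI[OF that, of ?f] by blast
    \<comment> \<open>Having more than \<open>K\<close> members, \<open>?Q\<close> is nonempty, so
      at least one requirement is present and yields \<open>Z c' d\<close>.\<close>
    obtain P0 where "P0 \<in> ?Q" using \<open>\<not> card ?Q \<le> K\<close> by (metis all_not_in_conv card.empty le0)
    then have "Z c' d" using c'R R_app g by blast
    then have "Q c' \<in> ?Q" using c'(1) by blast
    then show False using c'R R_app g by metis
  qed
  then show ?thesis by blast
qed

text \<open>Compactness gives finiteness for each list separately; the common bound comes from
  \<open>family_card_bound\<close>, applied once for each family and each pattern of length
  \<open>r\<close>.\<close>

lemma fits_D_bounded:
  "\<exists>N. \<forall>ls. set ls \<subseteq> instances \<times> UNIV \<and> length ls = r \<and> fits ls \<inter> D (Suc k) = {} \<longrightarrow>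
    finite (fits ls \<inter> D k) \<and> card (fits ls \<inter> D k) \<le> N"
proof -
  obtain \<Gamma> where \<Gamma>: "finite \<Gamma>" "\<forall>x\<in>\<Gamma>. family (fst x) (snd x)"
    "\<forall>P\<in>D 0. \<exists>x\<in>\<Gamma>. \<exists>c\<in>tuples (fst x). P = snd x c"
    by (rule families_cover)
  let ?T = "{\<tau>. set \<tau> \<subseteq> \<Delta> \<times> (UNIV :: bool set) \<and> length \<tau> = r}"
  let ?S = "\<lambda>x ls. snd x ` {c \<in> tuples (fst x). snd x c \<in> D k \<and> snd x c \<in> fits ls}"
  have T: "finite ?T" by (rule finite_lists_length_eq) (use finite_\<Delta> in simp)
  have "\<forall>y\<in>\<Gamma> \<times> ?T. \<exists>N. \<forall>d\<in>tuples (n * r).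
      finite (?S (fst y) (literal_list n (snd y) d)) \<longrightarrow>
      card (?S (fst y) (literal_list n (snd y) d)) \<le> N"
  proof
    fix y assume y: "y \<in> \<Gamma> \<times> ?T"
    define x \<tau> where "x = fst y" and "\<tau> = snd y"
    have fam: "family (fst x) (snd x)" using \<Gamma>(2) y by (auto simp: x_def)
    have \<tau>: "set \<tau> \<subseteq> \<Delta> \<times> UNIV" "length \<tau> = r" using y by (auto simp: \<tau>_def)
    have "definable2 (fst x) (n * r) (\<lambda>c d. snd x c \<in> D k)"
      unfolding definable2_def
      by (rule definable_comp[OF definable_D[OF fam]]
        coord_map_intros | simp)+
    then have "definable2 (fst x) (n * r)
        (\<lambda>c d. snd x c \<in> D k \<and> snd x c \<in> fits (literal_list n \<tau> d))"
      using family_fits[OF fam \<tau>(1)] unfolding definable2_def \<tau>(2) by (rule definable_conj)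
    from family_card_bound[OF fam this]
    show "\<exists>N. \<forall>d\<in>tuples (n * r). finite (?S (fst y) (literal_list n (snd y) d)) \<longrightarrow>
      card (?S (fst y) (literal_list n (snd y) d)) \<le> N" unfolding x_def \<tau>_def .
  qed
  then obtain N where N: "\<forall>y\<in>\<Gamma> \<times> ?T. \<forall>d\<in>tuples (n * r).
      finite (?S (fst y) (literal_list n (snd y) d)) \<longrightarrow>
      card (?S (fst y) (literal_list n (snd y) d)) \<le> N y" by (rule bchoice[THEN exE])
  show ?thesis
  \<comment> \<open>A given list has a single pattern, but summing over all patterns makes the bound
    depend on \<open>r\<close> and \<open>k\<close> alone.\<close>
  proof (intro exI[of _ "\<Sum>x\<in>\<Gamma>. \<Sum>\<tau>\<in>?T. N (x, \<tau>)"] allI impI, elim conjE)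
    fix ls assume ls: "set ls \<subseteq> instances \<times> UNIV" "length ls = r" "fits ls \<inter> D (Suc k) = {}"
    have fin: "finite (fits ls \<inter> D k)" using finite_fits_D[OF ls(1,3)] .
    obtain \<tau> d where \<tau>: "d \<in> tuples (n * length \<tau>)" "set \<tau> \<subseteq> \<Delta> \<times> UNIV" "length \<tau> = r"
      "literal_list n \<tau> d = ls"
      using literal_list_surj[OF ls(1)] unfolding ls(2) by (elim exE bexE conjE)
    have S_sub: "?S x ls \<subseteq> fits ls \<inter> D k" for x by auto
    have "fits ls \<inter> D k \<subseteq> (\<Union>x\<in>\<Gamma>. ?S x ls)"
    proof
      fix P assume P: "P \<in> fits ls \<inter> D k"
      then have "P \<in> D 0" using D_antimono[of 0 k] by auto
      then obtain x c where "x \<in> \<Gamma>" "c \<in> tuples (fst x)" "P = snd x c" using \<Gamma>(3) by blast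
      then show "P \<in> (\<Union>x\<in>\<Gamma>. ?S x ls)" using P by blast
    qed
    then have "card (fits ls \<inter> D k) \<le> card (\<Union>x\<in>\<Gamma>. ?S x ls)"
      using fin S_sub \<Gamma>(1) by (intro card_mono finite_UN_I finite_subset[OF S_sub fin])
    also have "\<dots> \<le> (\<Sum>x\<in>\<Gamma>. card (?S x ls))" by (rule card_UN_le[OF \<Gamma>(1)])
    also have "\<dots> \<le> (\<Sum>x\<in>\<Gamma>. \<Sum>\<tau>\<in>?T. N (x, \<tau>))"
    proof (rule sum_mono)
      fix x assume x: "x \<in> \<Gamma>"
      have "\<tau> \<in> ?T" using \<tau> by simp
      then have "card (?S x ls) \<le> N (x, \<tau>)"
        using bspec[OF bspec[OF N, of "(x, \<tau>)"], of d] x \<tau>(1,3,4) finite_subset[OF S_sub fin, of x]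
        by simp
      also have "\<dots> \<le> (\<Sum>\<tau>\<in>?T. N (x, \<tau>))"
        using member_le_sum[OF \<open>\<tau> \<in> ?T\<close>, of "\<lambda>\<tau>. N (x, \<tau>)"] T by simp
      finally show "card (?S x ls) \<le> (\<Sum>\<tau>\<in>?T. N (x, \<tau>))" .
    qed
    finally show "finite (fits ls \<inter> D k) \<and> card (fits ls \<inter> D k) \<le> (\<Sum>x\<in>\<Gamma>. \<Sum>\<tau>\<in>?T. N (x, \<tau>))"
      using fin by simp
  qed
qed

section \<open>Finite height and the polynomial bound on traces\<close>

lemma D_height:
  obtains \<rho> where "\<And>k. D k \<noteq> {} \<longleftrightarrow> k \<le> \<rho>"
proof -
  obtain h where h: "\<not> tree h (tuples m)"
    using tree_rank_bounded[OF stable finite_\<Delta> \<Delta>_formulas] by blast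
  have "D h = {}"
  proof (rule ccontr)
    assume "D h \<noteq> {}"
    then obtain P where "P \<in> D h" by blast
    then have "tree h (realizations [])" by (rule D_imp_tree) auto
    then show False using h by simp
  qed
  define \<rho> where "\<rho> = (LEAST k. D (Suc k) = {})"
  obtain a where "a \<in> tuples m" using tuples_nonempty by blast
  then have D0: "D 0 \<noteq> {}" using delta_type_in_D by blast
  then obtain h' where "h = Suc h'" using \<open>D h = {}\<close> by (cases h) blast+
  then have "D (Suc h') = {}" using \<open>D h = {}\<close> by simp
  then have "D (Suc \<rho>) = {}" unfolding \<rho>_def by (rule LeastI)
  moreover have "D \<rho> \<noteq> {}"
  proof (cases \<rho>)
    case 0
    then show ?thesis using D0 by simp
  next
    case (Suc k)
    then show ?thesis using not_less_Least[of k "\<lambda>k. D (Suc k) = {}"]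
      unfolding \<rho>_def[symmetric] by simp
  qed
  ultimately have "D k \<noteq> {} \<longleftrightarrow> k \<le> \<rho>" for k
    using D_antimono[of k \<rho>] D_antimono[of "Suc \<rho>" k]
    by (metis not_less_eq_eq subset_empty)
  then show ?thesis by (rule that)
qed

lemma card_traces_bound:
  assumes "D (Suc \<rho>) = {}"
  shows "\<exists>C. \<forall>F. F \<subseteq> instances \<and> finite F \<longrightarrow> card (traces F (D 0)) \<le> C * (1 + card F) ^ \<rho>"
proof -
  obtain C where "\<forall>ls F. set ls \<subseteq> instances \<times> UNIV \<and> length ls = 0 \<and> F \<subseteq> instances \<and> finite F \<and>
      fits ls \<inter> D (Suc \<rho>) = {} \<longrightarrow> card (traces F (fits ls \<inter> D 0)) \<le>
      C * (if Suc \<rho> = 0 then 0 else (1 + card F) ^ (Suc \<rho> - 1))"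
    \<comment> \<open>No literals are imposed, since \<open>fits [] = UNIV\<close>; missing
      \<open>D (Suc \<rho>)\<close> gives the exponent \<open>\<rho>\<close>.\<close>
    using card_traces_le[where D = D and I = instances and r = 0 and k = "Suc \<rho>",
        OF fits_D_bounded D_subset]
    by blast
  from this[THEN spec[of _ "[]"]] show ?thesis using assms by (intro exI[of _ C]) simp
qed

end

section \<open>Type spaces and local rank\<close>

lemma complete_types_Neg:
  assumes p: "p \<in> complete_types M m \<Delta> B" and "\<phi> \<in> \<Delta>" "b \<in> B"
  shows "(Neg \<phi>, b) \<in> p \<longleftrightarrow> (\<phi>, b) \<notin> p"
proof -
  have "(\<phi>, b) \<in> p \<or> (Neg \<phi>, b) \<in> p" using assms by (auto simp: complete_types_def)
  moreover have False if "(\<phi>, b) \<in> p" "(Neg \<phi>, b) \<in> p"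
  proof -
    have "consistent M m p" using p by (simp add: complete_types_def)
    then have "realized M m {(\<phi>, b), (Neg \<phi>, b)}" using that by (auto simp: consistent_def)
    then show False by (auto simp: realized_def realizes_def holds_def)
  qed
  ultimately show ?thesis by blast
qed

lemma complete_types_inj: "inj_on (\<lambda>p. p \<inter> \<Delta> \<times> B) (complete_types M m \<Delta> B)"
proof (rule inj_onI)
  fix p p' assume p: "p \<in> complete_types M m \<Delta> B" and p': "p' \<in> complete_types M m \<Delta> B"
    and eq: "p \<inter> \<Delta> \<times> B = p' \<inter> \<Delta> \<times> B"
  have "x \<in> p \<longleftrightarrow> x \<in> p'" if x: "x \<in> literals \<Delta> B" for x
  proof -
    obtain \<phi> b where \<phi>: "\<phi> \<in> \<Delta>" "b \<in> B" "x = (\<phi>, b) \<or> x = (Neg \<phi>, b)"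
      using x by (auto simp: literals_def)
    then have "(\<phi>, b) \<in> p \<longleftrightarrow> (\<phi>, b) \<in> p'" using eq by blast
    then show ?thesis
      using complete_types_Neg[OF p \<phi>(1,2)] complete_types_Neg[OF p' \<phi>(1,2)] \<phi>(3) by blast
  qed
  moreover have "p \<subseteq> literals \<Delta> B" "p' \<subseteq> literals \<Delta> B"
    using p p' by (simp_all add: complete_types_def)
  ultimately show "p = p'" by blast
qed

lemma consistent_x_eq_x: "consistent M m p \<Longrightarrow> consistent M m (p \<union> x_eq_x m)"
  unfolding consistent_def
proof (intro allI impI)
  fix q assume p: "\<forall>q\<subseteq>p. finite q \<longrightarrow> realized M m q" and q: "q \<subseteq> p \<union> x_eq_x m" "finite q"
  have "realized M m (q \<inter> p)" using p q(2) by simp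
  then obtain a where a: "a \<in> nlists m (univ M)" "realizes M a (q \<inter> p)"
    by (auto simp: realized_def)
  have "realizes M a q" unfolding realizes_def
  proof
    fix x assume x: "x \<in> q"
    show "case x of (\<phi>, b) \<Rightarrow> holds M \<phi> (a @ b)"
    proof (cases "x \<in> p")
      case True
      then show ?thesis using a(2) x unfolding realizes_def by blast
    next
      case False
      then have "x \<in> x_eq_x m" using x q(1) by blast
      then show ?thesis by (auto simp: x_eq_x_def holds_def)
    qed
  qed
  then show "realized M m q" using a(1) by (auto simp: realized_def)
qed

context local_types
begin

abbreviation global :: "('f, 'r, 'm) pfm set set" where
  "global \<equiv> global_types M m n \<Delta>"

abbreviation stone :: "('f, 'r, 'm) pfm set topology" where
  "stone \<equiv> stone_topology M m n \<Delta>"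

lemma global_Neg: "p \<in> global \<Longrightarrow> (\<phi>, b) \<in> instances \<Longrightarrow> (Neg \<phi>, b) \<in> p \<longleftrightarrow> (\<phi>, b) \<notin> p"
  unfolding global_types_def by (rule complete_types_Neg) auto

lemma global_eq_iff: "p \<in> global \<Longrightarrow> p' \<in> global \<Longrightarrow> p \<inter> instances = p' \<inter> instances \<longleftrightarrow> p = p'"
  unfolding global_types_def using complete_types_inj by (metis inj_onD)

lemma global_in_D_0:
  assumes p: "p \<in> global"
  shows "p \<inter> instances \<in> D 0"
proof -
  have "\<exists>a\<in>tuples m. delta_type a \<inter> F = (p \<inter> instances) \<inter> F" if F: "finite F" "F \<subseteq> instances" for F
  proof -
    let ?q = "(F \<union> (\<lambda>x. (Neg (fst x), snd x)) ` F) \<inter> p"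
    have "consistent M m p" using p by (simp add: global_types_def complete_types_def)
    then have "realized M m ?q" using F(1) unfolding consistent_def by simp
    then obtain a where a: "a \<in> tuples m" "realizes M a ?q" by (auto simp: realized_def)
    have "(\<phi>, b) \<in> delta_type a \<longleftrightarrow> (\<phi>, b) \<in> p" if i: "(\<phi>, b) \<in> F" for \<phi> b
    proof -
      have inst: "(\<phi>, b) \<in> instances" using i F(2) by blast
      show ?thesis
      proof (cases "(\<phi>, b) \<in> p")
        case True
        then have "holds M \<phi> (a @ b)" using a(2) i unfolding realizes_def by blast
        then show ?thesis using True inst by (simp add: delta_type_def)
      next
        case False
        then have "(Neg \<phi>, b) \<in> ?q" using global_Neg[OF p inst] i by force
        then have "holds M (Neg \<phi>) (a @ b)" using a(2) unfolding realizes_def by blast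
        then show ?thesis using False by (simp add: delta_type_def holds_def)
      qed
    qed
    then have "delta_type a \<inter> F = (p \<inter> instances) \<inter> F" using F(2) by auto
    then show ?thesis using a(1) by blast
  qed
  then show ?thesis by (simp add: D.simps(1))
qed

lemma D_0_global:
  assumes P: "P \<in> D 0"
  shows "\<exists>p\<in>global. p \<inter> instances = P"
proof -
  define p where "p = P \<union> {(Neg \<phi>, b) | \<phi> b. (\<phi>, b) \<in> instances \<and> (\<phi>, b) \<notin> P}"
  have sub: "P \<subseteq> instances" using P D_subset by blast
  have "consistent M m p" unfolding consistent_def
  proof (intro allI impI)
    fix q assume q: "q \<subseteq> p" "finite q"
    let ?neg = "\<lambda>x :: ('f, 'r, 'm) pfm. (Neg (fst x), snd x)"
    let ?F = "instances \<inter> (q \<union> ?neg -` q)"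
    have "inj ?neg" by (auto simp: inj_def)
    then have "finite (?neg -` q)" using q(2) by (rule finite_vimageI[rotated])
    then have "finite ?F" using q(2) by simp
    moreover have "?F \<subseteq> instances" by blast
    ultimately obtain a where a: "a \<in> tuples m" "delta_type a \<inter> ?F = P \<inter> ?F"
      using D_0_approx[OF P] by (metis (no_types, lifting))
    have "holds M \<psi> (a @ b)" if x: "(\<psi>, b) \<in> q" for \<psi> b
    proof (cases "(\<psi>, b) \<in> P")
      case True
      then have "(\<psi>, b) \<in> P \<inter> ?F" using x sub by blast
      then have "(\<psi>, b) \<in> delta_type a" using a(2) by blast
      then show ?thesis by (simp add: delta_type_def)
    next
      case False
      then obtain \<phi> where \<phi>: "\<psi> = Neg \<phi>" "(\<phi>, b) \<in> instances" "(\<phi>, b) \<notin> P"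
        using x q(1) unfolding p_def by blast
      then have "(\<phi>, b) \<in> ?F" using x by simp
      then have "(\<phi>, b) \<notin> delta_type a" using a(2) \<phi>(3) by blast
      then show ?thesis using \<phi> by (simp add: delta_type_def holds_def)
    qed
    then show "realized M m q" using a(1) by (auto simp: realized_def realizes_def)
  qed
  moreover have "p \<subseteq> literals \<Delta> (tuples n)" using sub by (auto simp: p_def literals_def)
  moreover have "\<forall>\<phi>\<in>\<Delta>. \<forall>b\<in>tuples n. (\<phi>, b) \<in> p \<or> (Neg \<phi>, b) \<in> p" by (auto simp: p_def)
  ultimately have "p \<in> global" by (simp add: global_types_def complete_types_def)
  \<comment> \<open>If \<open>Neg \<phi>\<close> belongs to \<Delta> as well, a negative literal
    added to form \<open>p\<close> is itself an instance, and it has to be in \<open>P\<close>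
    already for \<open>p \<inter> instances = P\<close> to hold.\<close>
  moreover have "(Neg \<phi>, b) \<in> P"
    if i: "(\<phi>, b) \<in> instances" "(\<phi>, b) \<notin> P" and n: "(Neg \<phi>, b) \<in> instances" for \<phi> b
  proof -
    let ?F = "{(\<phi>, b), (Neg \<phi>, b)}"
    have "finite ?F" "?F \<subseteq> instances" using i n by auto
    from D_0_approx[OF P this] obtain a where a: "delta_type a \<inter> ?F = P \<inter> ?F" by (elim bexE)
    then have "(\<phi>, b) \<notin> delta_type a" using i(2) by blast
    then have "(Neg \<phi>, b) \<in> delta_type a" using i(1) n by (simp add: delta_type_def holds_def)
    then show ?thesis using a by blast
  qed
  then have "p \<inter> instances = P" using sub unfolding p_def by blast
  ultimately show ?thesis by blast
qed

text \<open>Negative literals belong to the subbasis too, so both values of an instance can be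
  prescribed by open sets. With \<open>openin_stone_imp_agree\<close>, agreement on finite sets of
  instances is a neighbourhood base at \<open>p\<close>, the same as in the definition of
  \<open>D\<close>.\<close>

lemma openin_stone_agree:
  assumes p: "p \<in> global" and "finite F" "F \<subseteq> instances"
  shows "openin stone {q \<in> global. q \<inter> F = p \<inter> F}"
  using assms(2,3)
proof (induction F rule: finite_induct)
  case empty
  \<comment> \<open>For \<open>F = {}\<close> the set is the whole space, which is a member of the
    subbasis.\<close>
  then show ?case by (simp add: stone_topology_def topology_generated_by_Basis)
next
  case (insert i F)
  obtain \<phi> b where i: "i = (\<phi>, b)" by (cases i)
  define l where "l = (if i \<in> p then i else (Neg \<phi>, b))"
  have inst: "(\<phi>, b) \<in> instances" using insert.prems i by blast
  have l: "l \<in> q \<longleftrightarrow> (i \<in> q \<longleftrightarrow> i \<in> p)" if "q \<in> global" for q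
    using global_Neg[OF that inst] by (auto simp: l_def i)
  have "l \<in> literals \<Delta> (tuples n)" using inst by (auto simp: l_def i literals_def)
  then have "openin stone {q \<in> global. l \<in> q}"
    unfolding stone_topology_def by (intro topology_generated_by_Basis) blast
  with insert have "openin stone ({q \<in> global. q \<inter> F = p \<inter> F} \<inter> {q \<in> global. l \<in> q})"
    by (intro openin_Int) auto
  moreover have "{q \<in> global. q \<inter> F = p \<inter> F} \<inter> {q \<in> global. l \<in> q} =
      {q \<in> global. q \<inter> insert i F = p \<inter> insert i F}" using l by blast
  ultimately show ?case by simp
qed

lemma openin_stone_imp_agree:
  assumes "openin stone T" "p \<in> T" "p \<in> global"
  shows "\<exists>F. finite F \<and> F \<subseteq> instances \<and> (\<forall>q\<in>global. q \<inter> F = p \<inter> F \<longrightarrow> q \<in> T)"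
proof -
  have "generate_topology_on (insert global
      ((\<lambda>l. {p \<in> global. l \<in> p}) ` literals \<Delta> (tuples n))) T"
    using assms(1) unfolding stone_topology_def openin_topology_generated_by_iff .
  then show ?thesis using assms(2)
  proof (induction rule: generate_topology_on.induct)
    case Empty
    then show ?case by simp
  next
    case (Int A B)
    then obtain F F' where F: "finite F" "F \<subseteq> instances"
        "\<And>q. q \<in> global \<Longrightarrow> q \<inter> F = p \<inter> F \<Longrightarrow> q \<in> A"
      and F': "finite F'" "F' \<subseteq> instances"
        "\<And>q. q \<in> global \<Longrightarrow> q \<inter> F' = p \<inter> F' \<Longrightarrow> q \<in> B" by auto
    have "q \<in> A \<inter> B" if q: "q \<in> global" "q \<inter> (F \<union> F') = p \<inter> (F \<union> F')" for q
    proof -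
      have "q \<inter> F = p \<inter> F" "q \<inter> F' = p \<inter> F'" using q(2) by blast+
      then show ?thesis using F(3)[OF q(1)] F'(3)[OF q(1)] by simp
    qed
    then show ?case using F(1,2) F'(1,2) by (intro exI[of _ "F \<union> F'"]) simp
  next
    case (UN K)
    then obtain A where A: "A \<in> K" "p \<in> A" by blast
    from UN.IH[OF this] obtain F where "finite F" "F \<subseteq> instances"
      "\<forall>q\<in>global. q \<inter> F = p \<inter> F \<longrightarrow> q \<in> A" by (elim exE conjE)
    then show ?case using A(1) by (intro exI[of _ F]) auto
  next
    case (Basis A)
    then consider "A = global" | l where "l \<in> literals \<Delta> (tuples n)" "A = {p \<in> global. l \<in> p}"
      by blast
    then show ?case
    proof cases
      case 1
      then show ?thesis by (intro exI[of _ "{}"]) simp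
    next
      case (2 l)
      then obtain \<phi> b where i: "(\<phi>, b) \<in> instances" "l = (\<phi>, b) \<or> l = (Neg \<phi>, b)"
        by (auto simp: literals_def)
      have "q \<in> A" if q: "q \<in> global" "q \<inter> {(\<phi>, b)} = p \<inter> {(\<phi>, b)}" for q
        using global_Neg[OF q(1) i(1)] global_Neg[OF assms(3) i(1)] q 2(2) i(2) Basis.prems by blast
      then show ?thesis using i(1) by (intro exI[of _ "{(\<phi>, b)}"]) blast
    qed
  qed
qed

lemma in_stone_derived_set_iff:
  assumes p: "p \<in> global" and C: "C \<subseteq> global"
  shows "p \<in> stone derived_set_of C \<longleftrightarrow>
    (\<forall>F. finite F \<and> F \<subseteq> instances \<longrightarrow> (\<exists>q\<in>C. q \<noteq> p \<and> q \<inter> F = p \<inter> F))"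
proof
  assume lim: "p \<in> stone derived_set_of C"
  show "\<forall>F. finite F \<and> F \<subseteq> instances \<longrightarrow> (\<exists>q\<in>C. q \<noteq> p \<and> q \<inter> F = p \<inter> F)"
  proof (intro allI impI, elim conjE)
    fix F assume F: "finite F" "F \<subseteq> instances"
    have "p \<in> {q \<in> global. q \<inter> F = p \<inter> F}" using p by simp
    with lim openin_stone_agree[OF p F]
    obtain q where "q \<noteq> p" "q \<in> C" "q \<in> {q \<in> global. q \<inter> F = p \<inter> F}"
      unfolding in_derived_set_of by meson
    then show "\<exists>q\<in>C. q \<noteq> p \<and> q \<inter> F = p \<inter> F" by (intro bexI[of _ q]) simp_all
  qed
next
  assume approx: "\<forall>F. finite F \<and> F \<subseteq> instances \<longrightarrow> (\<exists>q\<in>C. q \<noteq> p \<and> q \<inter> F = p \<inter> F)"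
  have "openin stone global" using openin_stone_agree[OF p, of "{}"] by simp
  then have "p \<in> topspace stone" using p openin_subset by blast
  moreover have "\<exists>q. q \<noteq> p \<and> q \<in> C \<and> q \<in> T" if T: "p \<in> T" "openin stone T" for T
  proof -
    obtain F where F: "finite F \<and> F \<subseteq> instances" "\<forall>q\<in>global. q \<inter> F = p \<inter> F \<longrightarrow> q \<in> T"
      using openin_stone_imp_agree[OF T(2,1) p] by blast
    from approx[rule_format, OF F(1)] obtain q where "q \<in> C" "q \<noteq> p" "q \<inter> F = p \<inter> F"
      by (elim bexE conjE)
    then show ?thesis using F(2) C by blast
  qed
  ultimately show "p \<in> stone derived_set_of C" unfolding in_derived_set_of by blast
qed

text \<open>Positive parts identify \<open>global\<close> with \<open>D 0\<close>, and agreement on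
  a set of instances means the same on both sides, so limit points correspond at each level.\<close>

lemma cb_derivative_global: "cb_derivative stone k global = {p \<in> global. p \<inter> instances \<in> D k}"
proof (induction k)
  case 0
  then show ?case using global_in_D_0 by (auto simp: cb_derivative_def)
next
  case (Suc k)
  let ?C = "{p \<in> global. p \<inter> instances \<in> D k}"
  have "p \<in> stone derived_set_of ?C \<longleftrightarrow> p \<inter> instances \<in> D (Suc k)"
    if p: "p \<in> global" "p \<inter> instances \<in> D k" for p
  proof -
    have "(\<exists>q\<in>?C. q \<noteq> p \<and> q \<inter> F = p \<inter> F) \<longleftrightarrow>
        (\<exists>P'\<in>D k. P' \<noteq> p \<inter> instances \<and> P' \<inter> F = p \<inter> instances \<inter> F)"
      (is "?l \<longleftrightarrow> ?r") if F: "F \<subseteq> instances" for F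
    proof
      assume ?l
      then obtain q where q: "q \<in> global" "q \<inter> instances \<in> D k" "q \<noteq> p" "q \<inter> F = p \<inter> F" by blast
      then have "q \<inter> instances \<noteq> p \<inter> instances" using global_eq_iff[OF q(1) p(1)] by blast
      moreover have "q \<inter> instances \<inter> F = p \<inter> instances \<inter> F" using q(4) by blast
      ultimately show ?r using q(2) by (intro bexI[of _ "q \<inter> instances"] conjI)
    next
      assume ?r
      then obtain P' where P': "P' \<in> D k" "P' \<noteq> p \<inter> instances" "P' \<inter> F = p \<inter> instances \<inter> F"
        by (elim bexE conjE)
      then have "P' \<in> D 0" using D_antimono[of 0 k] by auto
      then obtain q where q: "q \<in> global" "q \<inter> instances = P'" using D_0_global by blast
      have "q \<inter> F = p \<inter> F" using P'(3) q(2) F by blast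
      moreover have "q \<noteq> p" using P'(2) q(2) by blast
      ultimately show ?l using q P'(1) by (intro bexI[of _ q]) simp_all
    qed
    then have "p \<in> stone derived_set_of ?C \<longleftrightarrow> (\<forall>F. finite F \<and> F \<subseteq> instances \<longrightarrow>
        (\<exists>P'\<in>D k. P' \<noteq> p \<inter> instances \<and> P' \<inter> F = p \<inter> instances \<inter> F))"
      using in_stone_derived_set_iff[OF p(1), of ?C] by simp
    then show ?thesis using p(2) by (simp add: D.simps(2))
  qed
  then have "?C \<inter> stone derived_set_of ?C = {p \<in> global. p \<inter> instances \<in> D (Suc k)}"
    using D_Suc_subset[of k] by blast
  then show ?case using Suc by (simp add: cb_derivative_def)
qed

lemma R_Delta_theory_eq:
  assumes "\<And>k. D k \<noteq> {} \<longleftrightarrow> k \<le> \<rho>"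
  shows "R_Delta_theory M m n \<Delta> = ereal (real \<rho>)"
proof -
  have "{p \<in> global. consistent M m (p \<union> x_eq_x m)} = global"
    using consistent_x_eq_x by (auto simp: global_types_def complete_types_def)
  moreover have "cb_derivative stone k global \<noteq> {} \<longleftrightarrow> k \<le> \<rho>" for k
  proof -
    have "cb_derivative stone k global \<noteq> {} \<longleftrightarrow> D k \<noteq> {}"
      unfolding cb_derivative_global using D_0_global D_antimono[of 0 k] by blast
    then show ?thesis using assms by simp
  qed
  moreover have "Sup ((\<lambda>k. ereal (real k)) ` {..\<rho>}) = ereal (real \<rho>)"
    by (intro antisym SUP_least SUP_upper) auto
  ultimately show ?thesis
    by (simp add: R_Delta_theory_def R_Delta_def cb_rank_def atMost_def)
qed

text \<open>The positive part of a type realized by \<open>a\<close> is the trace of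
  \<open>delta_type a\<close>, and a complete type is determined by its positive part.\<close>

lemma card_S_Delta_le:
  assumes "B \<subseteq> tuples n" "finite B"
  shows "card (S_Delta M m \<Delta> B) \<le> card (traces (\<Delta> \<times> B) (D 0))"
proof (rule card_inj_on_le)
  show "inj_on (\<lambda>p. p \<inter> \<Delta> \<times> B) (S_Delta M m \<Delta> B)"
    by (rule inj_on_subset[OF complete_types_inj]) (auto simp: S_Delta_def)
  show "(\<lambda>p. p \<inter> \<Delta> \<times> B) ` S_Delta M m \<Delta> B \<subseteq> traces (\<Delta> \<times> B) (D 0)"
  proof
    fix P assume "P \<in> (\<lambda>p. p \<inter> \<Delta> \<times> B) ` S_Delta M m \<Delta> B"
    then obtain p where p: "p \<in> complete_types M m \<Delta> B" "realized M m p" "P = p \<inter> \<Delta> \<times> B"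
      by (auto simp: S_Delta_def)
    then obtain a where a: "a \<in> tuples m" "realizes M a p" by (auto simp: realized_def)
    have "(\<phi>, b) \<in> p \<longleftrightarrow> (\<phi>, b) \<in> delta_type a" if i: "\<phi> \<in> \<Delta>" "b \<in> B" for \<phi> b
    proof -
      have "holds M \<phi> (a @ b)" if "(\<phi>, b) \<in> p" using a(2) that unfolding realizes_def by blast
      moreover have "holds M (Neg \<phi>) (a @ b)" if "(\<phi>, b) \<notin> p"
        using a(2) that complete_types_Neg[OF p(1) i] unfolding realizes_def by blast
      ultimately show ?thesis using i assms(1) by (auto simp: delta_type_def holds_def)
    qed
    then have "P = delta_type a \<inter> \<Delta> \<times> B" using p(3) by auto
    then show "P \<in> traces (\<Delta> \<times> B) (D 0)" using delta_type_in_D[OF a(1)] by blast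
  qed
  show "finite (traces (\<Delta> \<times> B) (D 0))" using assms finite_\<Delta> by (intro finite_traces) simp
qed

lemma pi_dual_bound:
  assumes "D (Suc \<rho>) = {}"
  obtains C :: nat where "\<And>t. 1 \<le> t \<Longrightarrow> pi_dual M m n \<Delta> t \<le> C * t ^ \<rho>"
proof -
  obtain C where C: "\<And>F. F \<subseteq> instances \<Longrightarrow> finite F \<Longrightarrow>
      card (traces F (D 0)) \<le> C * (1 + card F) ^ \<rho>" using card_traces_bound[OF assms] by blast
  have "pi_dual M m n \<Delta> t \<le> C * (1 + card \<Delta>) ^ \<rho> * t ^ \<rho>" if t: "1 \<le> t" for t
  proof -
    let ?S = "{card (S_Delta M m \<Delta> B) | B. B \<subseteq> tuples n \<and> finite B \<and> card B = t}"
    have le: "s \<le> C * (1 + card \<Delta>) ^ \<rho> * t ^ \<rho>" if s: "s \<in> ?S" for s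
    proof -
      obtain B where B: "B \<subseteq> tuples n" "finite B" "card B = t" "s = card (S_Delta M m \<Delta> B)"
        using s unfolding mem_Collect_eq by (elim exE conjE)
      have "s \<le> card (traces (\<Delta> \<times> B) (D 0))" using card_S_Delta_le B by simp
      also have "\<dots> \<le> C * (1 + card (\<Delta> \<times> B)) ^ \<rho>" using B finite_\<Delta> by (intro C) auto
      \<comment> \<open>For \<open>t \<ge> 1\<close> the summand 1 is absorbed into a multiple of
        \<open>t\<close>.\<close>
      also have "\<dots> \<le> C * ((1 + card \<Delta>) * t) ^ \<rho>"
        using t B(3) by (intro mult_le_mono2 power_mono) (auto simp: card_cartesian_product)
      finally show ?thesis by (simp only: power_mult_distrib mult.assoc)
    qed
    show ?thesis
    proof (cases "?S = {}")
      case True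
      then show ?thesis unfolding pi_dual_def by (simp only: Sup_nat_empty le0)
    next
      case False
      then show ?thesis unfolding pi_dual_def by (rule cSup_least) (rule le)
    qed
  qed
  then show ?thesis by (rule that)
qed

lemma pi_dual_bigo:
  assumes "D (Suc \<rho>) = {}"
  shows "(\<lambda>t. real (pi_dual M m n \<Delta> t)) \<in> O(\<lambda>t. real t ^ \<rho>)"
proof -
  obtain C :: nat where C: "\<And>t. 1 \<le> t \<Longrightarrow> pi_dual M m n \<Delta> t \<le> C * t ^ \<rho>"
    by (rule pi_dual_bound[OF assms]) blast
  show ?thesis
  proof (rule bigoI[of _ "real C"])
    show "\<forall>\<^sub>F t in sequentially. norm (real (pi_dual M m n \<Delta> t)) \<le> real C * norm (real t ^ \<rho>)"
      using eventually_ge_at_top[of 1]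
    proof eventually_elim
      case (elim t)
      then have "real (pi_dual M m n \<Delta> t) \<le> real (C * t ^ \<rho>)" using C by (simp only: of_nat_le_iff)
      then show ?case by simp
    qed
  qed
qed

end

theorem theorem3p1:
  fixes L :: "('f, 'r) language" and T :: "('f, 'r) fm set"
    and M :: "('f, 'r, 'm) fo_struct" and \<kappa> :: "'k rel"
    and m n :: nat and \<Delta> :: "('f, 'r) fm set"
  assumes "complete_theory TYPE('m) L T"
    and "no_finite_models TYPE('m) L T"
    and "monster_model \<kappa> L T M"
    and "stable_theory L M"
    and "\<not> finite_cover_property L M"
    and "finite \<Delta>" and "\<Delta> \<subseteq> formulas_in L (m + n)"
  shows "\<exists>\<rho> :: nat. R_Delta_theory M m n \<Delta> = ereal (real \<rho>) \<and>
           (\<lambda>t. real (pi_dual M m n \<Delta> t)) \<in> O(\<lambda>t. real t ^ \<rho>) \<and>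
           vc_dual M m n \<Delta> \<le> ereal (real \<rho>)"
proof -
  interpret local_types L M \<Delta> m n
  proof
    show "is_structure L M" using assms(3) by (simp add: monster_model_def models_def)
  next
    fix m and A :: "'m set" and p :: "('f, 'r, 'm) pfm set"
    assume *: "finite A" "A \<subseteq> univ M"
      "p \<subseteq> {(\<phi>, b). set b \<subseteq> A \<and> \<phi> \<in> formulas_in L (m + length b)}" "consistent M m p"
    \<comment> \<open>There are infinitely many formulas even over the empty language, so a finite
      \<open>A\<close> is smaller than \<open>formulas L\<close> and thus than
      \<open>\<kappa>\<close>.\<close>
    have "(\<lambda>i. Eq (Var i) (Var i)) ` UNIV \<subseteq> formulas L" by (auto simp: formulas_def)
    moreover have "inj (\<lambda>i. Eq (Var i) (Var i) :: ('f, 'r) fm)" by (auto simp: inj_def)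
    ultimately have "infinite (formulas L)" by (meson finite_imageD finite_subset infinite_UNIV_nat)
    then have "|A| <o |formulas L|"
      using *(1) by (metis card_of_Well_order card_of_ordLeq_finite not_ordLeq_iff_ordLess)
    also have "|formulas L| <o \<kappa>" using assms(3) by (simp add: monster_model_def)
    finally have "|A| <o \<kappa>" .
    then show "realized M m p"
      using assms(3) * unfolding monster_model_def saturated_def by blast
  qed (fact assms)+
  obtain \<rho> where \<rho>: "\<And>k. D k \<noteq> {} \<longleftrightarrow> k \<le> \<rho>" by (rule D_height) blast
  have bigo: "(\<lambda>t. real (pi_dual M m n \<Delta> t)) \<in> O(\<lambda>t. real t ^ \<rho>)"
    by (rule pi_dual_bigo) (use \<rho>[of "Suc \<rho>"] in simp)
  moreover have "vc_dual M m n \<Delta> \<le> ereal (real \<rho>)"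
  proof -
    \<comment> \<open>The two powers may differ at \<open>t = 0\<close>, where
      \<open>0 ^ 0 = 1\<close> but \<open>0 powr 0 = 0\<close>.\<close>
    have "\<forall>\<^sub>F t in sequentially. real t ^ \<rho> = real t powr real \<rho>"
      using eventually_gt_at_top[of 0] by eventually_elim (simp add: powr_realpow)
    then have "(\<lambda>t. real (pi_dual M m n \<Delta> t)) \<in> O(\<lambda>t. real t powr real \<rho>)"
      using bigo landau_o.big.cong[of "\<lambda>t. real t ^ \<rho>" "\<lambda>t. real t powr real \<rho>" sequentially]
      by blast
    then show ?thesis unfolding vc_dual_def by (intro Inf_lower imageI) simp
  qed
  ultimately show ?thesis using R_Delta_theory_eq[OF \<rho>] by blast
qed

end
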